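(* The quaternary quadratic form $Q_{27}^3=x^2+2y^2+4z^2+5w^2+4zw+2yz$ (equivalently, the form with Gram matrix $\begin{pmatrix}1&0&0&0\\0&2&0&1\\0&0&5&2\\0&1&2&4\end{pmatrix}$) is primitively universal.
   Context: A quadratic form $f$ in variables $x,y,z,w$ is primitively universal if for every positive integer $n$ the equation $f(x,y,z,w)=n$ has an integer solution with $\gcd(x,y,z,w)=1$. *)

theory Defs
  imports "HOL-Analysis.Analysis"
begin

definition primitively_universal :: "(int \<Rightarrow> int \<Rightarrow> int \<Rightarrow> int \<Rightarrow> int) \<Rightarrow> bool" where
  "primitively_universal f \<longleftrightarrow>
    (\<forall>n>0. \<exists>x y z w. f x y z w = n \<and> Gcd {x, y, z, w} = 1)"

definition Q27_3 :: "int \<Rightarrow> int \<Rightarrow> int \<Rightarrow> int \<Rightarrow> int" where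
  "Q27_3 x y z w = x^2 + 2 * y^2 + 4 * z^2 + 5 * w^2 + 4 * z * w + 2 * y * z"

definition Q27_3_gram :: "int ^ 4 ^ 4" where
  "Q27_3_gram = vector [vector [1, 0, 0, 0],
                        vector [0, 2, 0, 1],
                        vector [0, 0, 5, 2],
                        vector [0, 1, 2, 4]]"

text \<open>The rows and columns of the Gram matrix are indexed by the variables in the order
  \<open>x, y, w, z\<close>.\<close>

lemma vector_4:
  "(vector [a, b, c, d] :: ('a::zero) ^ 4) $ 1 = a"
  "(vector [a, b, c, d] :: ('a::zero) ^ 4) $ 2 = b"
  "(vector [a, b, c, d] :: ('a::zero) ^ 4) $ 3 = c"
  "(vector [a, b, c, d] :: ('a::zero) ^ 4) $ 4 = d"
  unfolding vector_def by simp_all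

lemma Q27_3_eq_gram:
  fixes x y z w :: int
  defines "v \<equiv> (vector [x, y, w, z] :: int ^ 4)"
  shows "Q27_3 x y z w = (\<Sum>i\<in>UNIV. v $ i * (Q27_3_gram *v v) $ i)"
  by (simp add: v_def Q27_3_def Q27_3_gram_def matrix_vector_mult_def sum_4 vector_4
      power2_eq_square algebra_simps)

end

theory Submission
  imports Defs "HOL-Number_Theory.Number_Theory" "HOL-Computational_Algebra.Nth_Powers"
begin

text \<open>In the coordinates \<open>a = y + z - w\<close>, \<open>b = - y - w\<close>, \<open>c = x\<close>, \<open>d = z + w\<close> the form becomes
  \<open>a\<^sup>2 + b\<^sup>2 + c\<^sup>2 + 3 d\<^sup>2\<close> on the lattice \<open>d \<equiv> a + b (mod 3)\<close>. If \<open>n - 3 d\<^sup>2\<close> is a primitive sum of three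
  squares, then permuting these and changing signs achieves the congruence; one of \<open>d = 0, 1, 2\<close>
  makes \<open>n - 3 d\<^sup>2\<close> incongruent to 0, 4, 7 modulo 8, except for \<open>n = 7\<close>.

  For the three squares theorem, \<open>m\<close> is placed on the diagonal of a positive ternary matrix of
  determinant 1, which reduces to the identity. The matrix requires a number \<open>h\<close> in a prescribed
  quadratic residue class such that \<open>- m\<close> is a square modulo \<open>h\<close>. Dirichlet took \<open>h\<close> to be a prime (or
  twice a prime) in an arithmetic progression; here a product of primes is enough. If none existed,
  there would be two nonprincipal quadratic characters \<open>\<phi>\<close>, \<open>\<psi>\<close> that are never \<open>-1\<close> at the same prime,
  so the Dirichlet convolution \<open>g\<close> of \<open>\<phi>\<close> and \<open>\<psi>\<close> would be nonnegative and at least 1 at squares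
  coprime to the modulus. Then the partial sums of \<open>g(n) / \<surd>n\<close> would be unbounded, contradicting
  the hyperbola method.\<close>

section \<open>The hyperbola method\<close>

text \<open>Summation by parts: the partial sums \<open>F\<close> are bounded by \<open>B\<close>,
  and they are paired with the differences \<open>w i - w (Suc i)\<close>, which are nonnegative and
  telescope to \<open>w a - w b\<close>.\<close>

lemma abel_inequality:
  fixes f w :: "nat \<Rightarrow> real"
  assumes bound: "\<And>b. \<bar>\<Sum>i\<in>{a..<b}. f i\<bar> \<le> B"
    and anti: "\<And>i. a \<le> i \<Longrightarrow> w (Suc i) \<le> w i"
    and nonneg: "\<And>i. a \<le> i \<Longrightarrow> 0 \<le> w i"
  shows "\<bar>\<Sum>i\<in>{a..<b}. f i * w i\<bar> \<le> B * w a"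
proof (cases "a \<le> b")
  case True
  have B: "0 \<le> B" using bound[of a] by simp
  define F where "F k = (\<Sum>i\<in>{a..<k}. f i)" for k
  have F: "\<bar>F k\<bar> \<le> B" for k using bound unfolding F_def .
  have parts: "(\<Sum>i\<in>{a..<b}. f i * w i) = F b * w b + (\<Sum>i\<in>{a..<b}. F (Suc i) * (w i - w (Suc i)))"
    using True by (induction b rule: dec_induct) (simp_all add: F_def algebra_simps)
  have tel: "(\<Sum>i\<in>{a..<b}. w i - w (Suc i)) = w a - w b"
    using True by (induction b rule: dec_induct) simp_all
  have "\<bar>\<Sum>i\<in>{a..<b}. F (Suc i) * (w i - w (Suc i))\<bar> \<le> (\<Sum>i\<in>{a..<b}. B * (w i - w (Suc i)))"
    by (rule order_trans[OF sum_abs]) (auto intro!: sum_mono mult_mono F anti B simp: abs_mult)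
  also have "\<dots> = B * (w a - w b)" by (simp add: sum_distrib_left[symmetric] tel)
  finally have "\<bar>\<Sum>i\<in>{a..<b}. F (Suc i) * (w i - w (Suc i))\<bar> \<le> B * (w a - w b)" .
  moreover have "\<bar>F b * w b\<bar> \<le> B * w b"
    using F[of b] nonneg[OF True] by (simp add: abs_mult mult_right_mono)
  ultimately show ?thesis unfolding parts right_diff_distrib by linarith
next
  case False
  then show ?thesis using bound[of a] nonneg[of a] by simp
qed

text \<open>For consecutive square roots \<open>s\<close> and \<open>t\<close>, the inequality
  \<open>0 \<le> (t - s)^2\<close> with \<open>t^2 = s^2 + 1\<close> gives
  \<open>1 / t \<le> 2 * t - 2 * s\<close>, which telescopes.\<close>

lemma sum_inverse_sqrt_le: "(\<Sum>i\<in>{1..n}. 1 / sqrt (real i)) \<le> 2 * sqrt (real n)"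
proof (induction n)
  case (Suc n)
  define s t where "s = sqrt (real n)" and "t = sqrt (real (Suc n))"
  have st: "t\<^sup>2 = s\<^sup>2 + 1" "0 \<le> s" "0 < t" by (simp_all add: s_def t_def)
  have "0 \<le> (t - s)\<^sup>2" by simp
  then have "1 + 2 * s * t \<le> 2 * t * t" using st(1) by (simp add: power2_eq_square algebra_simps)
  then have "1 / t \<le> 2 * t - 2 * s" using st(3) by (simp add: field_simps)
  then show ?case using Suc by (simp add: s_def t_def)
qed simp

definition hyperbola_region :: "nat \<Rightarrow> (nat \<times> nat) set" where
  "hyperbola_region X = {(d, e). 1 \<le> d \<and> 1 \<le> e \<and> d * e \<le> X}"

lemma sum_divisors_eq_sum_hyperbola_region:
  fixes h :: "nat \<Rightarrow> nat \<Rightarrow> 'a::comm_monoid_add"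
  shows "(\<Sum>n\<in>{1..X}. \<Sum>d | d dvd n. h d (n div d)) = (\<Sum>(d, e)\<in>hyperbola_region X. h d e)"
proof -
  have "(\<Sum>n\<in>{1..X}. \<Sum>d | d dvd n. h d (n div d)) =
      (\<Sum>(n, d)\<in>Sigma {1..X} (\<lambda>n. {d. d dvd n}). h d (n div d))"
    by (rule sum.Sigma) auto
  also have "\<dots> = (\<Sum>(d, e)\<in>hyperbola_region X. h d e)"
    by (rule sum.reindex_bij_witness[of _ "\<lambda>(d, e). (d * e, d)" "\<lambda>(n, d). (d, n div d)"])
      (auto simp: hyperbola_region_def Suc_le_eq elim!: dvdE)
  finally show ?thesis .
qed

text \<open>The square \<open>S\<close> contributes a product of two bounded sums. On
  \<open>P\<close>, where \<open>d \<le> Y < e\<close>, each inner sum is at most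
  \<open>C / sqrt Y\<close> and the outer weights add up to at most \<open>2 * sqrt Y\<close>, so
  the bound is free of \<open>Y\<close>. The set \<open>Q\<close> is the mirror image of
  \<open>P\<close>.\<close>

lemma hyperbola_bound:
  fixes F G :: "nat \<Rightarrow> real"
  assumes F: "\<And>a b. 1 \<le> a \<Longrightarrow> \<bar>\<Sum>i\<in>{a..<b}. F i\<bar> \<le> C / sqrt a"
    and G: "\<And>a b. 1 \<le> a \<Longrightarrow> \<bar>\<Sum>i\<in>{a..<b}. G i\<bar> \<le> C / sqrt a"
    and F1: "\<And>i. \<bar>F i\<bar> \<le> 1 / sqrt i"
    and G1: "\<And>i. \<bar>G i\<bar> \<le> 1 / sqrt i"
    and "Y > 0"
  shows "\<bar>\<Sum>(d, e)\<in>hyperbola_region (Y\<^sup>2). F d * G e\<bar> \<le> C\<^sup>2 + 4 * C"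
proof -
  define S where "S = {1..Y} \<times> {1..Y}"
  define P where "P = Sigma {1..Y} (\<lambda>d. {Suc Y..<Suc (Y\<^sup>2 div d)})"
  define Q where "Q = (\<lambda>(e, d). (d, e)) ` P"
  have C: "0 \<le> C" using F[of 1 1] by simp
  have swap: "inj_on (\<lambda>(e, d). (d, e)) P" by (auto simp: inj_on_def)
  have fin: "finite S" "finite P" "finite Q" by (auto simp: S_def P_def Q_def)
  have reg: "hyperbola_region (Y\<^sup>2) = S \<union> (P \<union> Q)"
  proof -
    have "d \<le> Y \<or> e \<le> Y" if "d * e \<le> Y\<^sup>2" for d e
    proof (rule ccontr)
      assume "\<not> (d \<le> Y \<or> e \<le> Y)"
      then have "Y * Y < d * e" by (intro mult_strict_mono) auto
      then show False using that by (simp add: power2_eq_square)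
    qed
    moreover have "d * e \<le> Y\<^sup>2" if "d \<le> Y" "e \<le> Y" for d e
      using mult_le_mono[OF that] by (simp add: power2_eq_square)
    moreover have "e < Suc (Y\<^sup>2 div d) \<longleftrightarrow> d * e \<le> Y\<^sup>2" if "1 \<le> d" for d e
      using that by (simp add: less_Suc_eq_le less_eq_div_iff_mult_less_eq mult.commute)
    ultimately show ?thesis
      by (auto simp: hyperbola_region_def S_def P_def Q_def image_iff less_Suc_eq_le
          not_less_eq_eq mult.commute) (metis not_less_eq_eq)+
  qed
  have disj: "S \<inter> (P \<union> Q) = {}" "P \<inter> Q = {}" by (auto simp: S_def P_def Q_def)
  have sq: "sqrt (real Y) > 0" using \<open>Y > 0\<close> by simp
  have tail: "\<bar>\<Sum>(d, e)\<in>P. H d * K e\<bar> \<le> 2 * C"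
    if H: "\<And>i. \<bar>H i\<bar> \<le> 1 / sqrt i"
      and K: "\<And>a b. 1 \<le> a \<Longrightarrow> \<bar>\<Sum>i\<in>{a..<b}. K i\<bar> \<le> C / sqrt a" for H K :: "nat \<Rightarrow> real"
  proof -
    have "(\<Sum>(d, e)\<in>P. H d * K e) = (\<Sum>d\<in>{1..Y}. H d * (\<Sum>e\<in>{Suc Y..<Suc (Y\<^sup>2 div d)}. K e))"
      by (simp add: P_def sum.Sigma sum_distrib_left del: sum.op_ivl_Suc)
    also have "\<bar>\<dots>\<bar> \<le> (\<Sum>d\<in>{1..Y}. 1 / sqrt d * (C / sqrt Y))"
    proof (rule order_trans[OF sum_abs], rule sum_mono)
      fix d assume "d \<in> {1..Y}"
      have "\<bar>\<Sum>e\<in>{Suc Y..<Suc (Y\<^sup>2 div d)}. K e\<bar> \<le> C / sqrt (Suc Y)"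
        by (rule K) simp
      also have "\<dots> \<le> C / sqrt Y" using C sq by (intro divide_left_mono) auto
      finally show "\<bar>H d * (\<Sum>e\<in>{Suc Y..<Suc (Y\<^sup>2 div d)}. K e)\<bar> \<le> 1 / sqrt d * (C / sqrt Y)"
        unfolding abs_mult by (intro mult_mono H) auto
    qed
    also have "\<dots> = (\<Sum>d\<in>{1..Y}. 1 / sqrt d) * (C / sqrt Y)" by (simp only: sum_distrib_right)
    also have "\<dots> \<le> 2 * sqrt Y * (C / sqrt Y)"
      using C sq by (intro mult_right_mono sum_inverse_sqrt_le) auto
    also have "\<dots> = 2 * C" using sq by simp
    finally show ?thesis .
  qed
  have "\<bar>\<Sum>(d, e)\<in>Q. F d * G e\<bar> \<le> 2 * C"
    using tail[OF G1 F] unfolding Q_def by (subst sum.reindex[OF swap]) (simp add: case_prod_unfold mult.commute)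
  moreover have "\<bar>\<Sum>(d, e)\<in>P. F d * G e\<bar> \<le> 2 * C" by (rule tail[OF F1 G])
  moreover have "\<bar>\<Sum>(d, e)\<in>S. F d * G e\<bar> \<le> C\<^sup>2"
  proof -
    have "(\<Sum>(d, e)\<in>S. F d * G e) = (\<Sum>d\<in>{1..<Suc Y}. F d) * (\<Sum>e\<in>{1..<Suc Y}. G e)"
      unfolding S_def by (simp add: sum_product sum.cartesian_product atLeastLessThanSuc_atLeastAtMost)
    moreover have "\<bar>\<Sum>d\<in>{1..<Suc Y}. F d\<bar> \<le> C" using F[of 1 "Suc Y"] by simp
    moreover have "\<bar>\<Sum>d\<in>{1..<Suc Y}. G d\<bar> \<le> C" using G[of 1 "Suc Y"] by simp
    ultimately show ?thesis
      by (simp only: abs_mult power2_eq_square) (intro mult_mono C abs_ge_zero)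
  qed
  moreover have "(\<Sum>(d, e)\<in>hyperbola_region (Y\<^sup>2). F d * G e) =
      (\<Sum>(d, e)\<in>S. F d * G e) + ((\<Sum>(d, e)\<in>P. F d * G e) + (\<Sum>(d, e)\<in>Q. F d * G e))"
    unfolding reg by (simp only: sum.union_disjoint fin disj finite_UnI)
  ultimately show ?thesis by linarith
qed

section \<open>Quadratic characters\<close>

text \<open>Real Dirichlet characters modulo \<open>N\<close>, the principal one included; where a
  character has to be nonprincipal, an argument with value -1 is assumed.\<close>

definition quadratic_character :: "nat \<Rightarrow> (nat \<Rightarrow> int) \<Rightarrow> bool" where
  "quadratic_character N \<xi> \<longleftrightarrow>
    (\<forall>x. \<xi> x \<in> {-1, 0, 1}) \<and> (\<forall>x. \<xi> x = 0 \<longleftrightarrow> \<not> coprime x N) \<and> \<xi> 1 = 1 \<and>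
    (\<forall>x y. \<xi> (x * y) = \<xi> x * \<xi> y) \<and> (\<forall>x y. [x = y] (mod N) \<longrightarrow> \<xi> x = \<xi> y)"

lemma
  assumes "quadratic_character N \<xi>"
  shows quadratic_character_values: "\<xi> x \<in> {-1, 0, 1}"
    and quadratic_character_eq_0_iff: "\<xi> x = 0 \<longleftrightarrow> \<not> coprime x N"
    and quadratic_character_1: "\<xi> 1 = 1"
    and quadratic_character_mult: "\<xi> (x * y) = \<xi> x * \<xi> y"
    and quadratic_character_cong: "[x = y] (mod N) \<Longrightarrow> \<xi> x = \<xi> y"
  using assms unfolding quadratic_character_def by blast+

lemma quadratic_character_coprime:
  assumes "quadratic_character N \<xi>" "coprime x N"
  shows "\<xi> x = 1 \<or> \<xi> x = -1"
  using quadratic_character_values[OF assms(1), of x] quadratic_character_eq_0_iff[OF assms(1), of x]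
    assms(2) by auto

lemma quadratic_character_power:
  assumes "quadratic_character N \<xi>"
  shows "\<xi> (x ^ k) = \<xi> x ^ k"
  by (induction k) (use quadratic_character_1[OF assms] quadratic_character_mult[OF assms] in simp_all)

lemma quadratic_character_prod:
  assumes "quadratic_character N \<xi>" "quadratic_character N \<psi>"
  shows "quadratic_character N (\<lambda>x. \<xi> x * \<psi> x)"
proof -
  have "\<xi> x * \<psi> x \<in> {-1, 0, 1}" for x
    using quadratic_character_values[OF assms(1), of x] quadratic_character_values[OF assms(2), of x]
    by auto
  then show ?thesis using assms unfolding quadratic_character_def by (auto simp: algebra_simps)
qed

text \<open>Multiplication by \<open>t\<close> permutes the residues and changes the sign of each
  value, so the sum equals its own negative.\<close>

lemma sum_quadratic_character_period:
  assumes \<xi>: "quadratic_character N \<xi>" and "N > 0" and t: "\<xi> t = -1"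
  shows "(\<Sum>x<N. \<xi> x) = 0"
proof -
  have "coprime t N" using t quadratic_character_eq_0_iff[OF \<xi>, of t] by simp
  have inj: "inj_on (\<lambda>x. t * x mod N) {..<N}"
  proof (rule inj_onI)
    fix x y assume *: "x \<in> {..<N}" "y \<in> {..<N}" "t * x mod N = t * y mod N"
    then have "[x = y] (mod N)"
      using \<open>coprime t N\<close> by (simp add: cong_def[symmetric] cong_mult_lcancel_nat)
    then show "x = y" using * by (simp add: cong_def)
  qed
  have "(\<lambda>x. t * x mod N) ` {..<N} = {..<N}"
    by (rule endo_inj_surj[OF _ _ inj]) (use \<open>N > 0\<close> in auto)
  then have bij: "bij_betw (\<lambda>x. t * x mod N) {..<N} {..<N}" using inj by (simp add: bij_betw_def)
  have "(\<Sum>x<N. \<xi> x) = (\<Sum>x<N. \<xi> (t * x mod N))"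
    by (rule sum.reindex_bij_betw[OF bij, symmetric])
  also have "\<dots> = (\<Sum>x<N. - \<xi> x)"
  proof (rule sum.cong[OF refl])
    fix x
    have "\<xi> (t * x mod N) = \<xi> (t * x)" by (rule quadratic_character_cong[OF \<xi>]) (simp add: cong_def)
    then show "\<xi> (t * x mod N) = - \<xi> x" using t by (simp add: quadratic_character_mult[OF \<xi>])
  qed
  finally show ?thesis by (simp add: sum_negf)
qed

text \<open>Full periods cancel, so at most \<open>N\<close> terms of an initial sum are left; an
  interval is a difference of two initial sums, whence the factor 2.\<close>

lemma sum_quadratic_character_bound:
  assumes \<xi>: "quadratic_character N \<xi>" and "N > 0" and t: "\<xi> t = -1"
  shows "\<bar>\<Sum>x\<in>{a..<b}. \<xi> x\<bar> \<le> 2 * int N"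
proof -
  have abs1: "\<bar>\<xi> x\<bar> \<le> 1" for x using quadratic_character_values[OF \<xi>, of x] by auto
  have shift: "\<xi> (x + N * k) = \<xi> x" for x k
    by (rule quadratic_character_cong[OF \<xi>]) (simp add: cong_def)
  have period: "(\<Sum>x<N * k. \<xi> x) = 0" for k
  proof (induction k)
    case (Suc k)
    have "(\<Sum>x\<in>{N * k..<N * k + N}. \<xi> x) = (\<Sum>x<N. \<xi> (x + N * k))"
      using sum.shift_bounds_nat_ivl[of \<xi> 0 "N * k" N] by (simp add: add.commute lessThan_atLeast0)
    also have "\<dots> = 0" using sum_quadratic_character_period[OF assms] by (simp add: shift)
    finally have "(\<Sum>x\<in>{N * k..<N * k + N}. \<xi> x) = 0" .
    moreover have "(\<Sum>x<N * Suc k. \<xi> x) = (\<Sum>x<N * k. \<xi> x) + (\<Sum>x\<in>{N * k..<N * k + N}. \<xi> x)"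
      by (simp add: lessThan_atLeast0 sum.atLeastLessThan_concat add.commute)
    ultimately show ?case using Suc by simp
  qed simp
  have init: "\<bar>\<Sum>x<b. \<xi> x\<bar> \<le> int N" for b
  proof -
    define k where "k = b div N"
    have b: "N * k \<le> b" "b - N * k \<le> N"
      using \<open>N > 0\<close> by (simp_all add: k_def minus_mult_div_eq_mod less_imp_le)
    have "(\<Sum>x<b. \<xi> x) = (\<Sum>x<N * k. \<xi> x) + (\<Sum>x\<in>{N * k..<b}. \<xi> x)"
      using b by (simp add: lessThan_atLeast0 sum.atLeastLessThan_concat)
    also have "\<dots> = (\<Sum>x\<in>{N * k..<b}. \<xi> x)" using period by simp
    also have "\<bar>\<dots>\<bar> \<le> (\<Sum>x\<in>{N * k..<b}. 1)" by (rule order_trans[OF sum_abs]) (intro sum_mono abs1)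
    also have "\<dots> = int (b - N * k)" by simp
    also have "\<dots> \<le> int N" using b(2) by (simp only: of_nat_le_iff)
    finally show ?thesis .
  qed
  show ?thesis
  proof (cases "a \<le> b")
    case True
    then have "(\<Sum>x<b. \<xi> x) = (\<Sum>x<a. \<xi> x) + (\<Sum>x\<in>{a..<b}. \<xi> x)"
      by (simp add: lessThan_atLeast0 sum.atLeastLessThan_concat)
    then show ?thesis using init[of a] init[of b] by linarith
  qed simp
qed

text \<open>Abel's inequality with weights \<open>1 / sqrt i\<close>. The sum starts at 1 or later
  because \<open>1 / sqrt 0\<close> is 0 in HOL, so the weights do not decrease from 0 to 1.\<close>

lemma sum_quadratic_character_sqrt_bound:
  assumes \<xi>: "quadratic_character N \<xi>" and "N > 0" and t: "\<xi> t = -1" and "1 \<le> a"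
  shows "\<bar>\<Sum>x\<in>{a..<b}. real_of_int (\<xi> x) / sqrt x\<bar> \<le> 2 * real N / sqrt a"
proof -
  have "\<bar>\<Sum>x\<in>{a..<b}. real_of_int (\<xi> x) * (1 / sqrt x)\<bar> \<le> 2 * real N * (1 / sqrt a)"
  proof (rule abel_inequality)
    show "\<bar>\<Sum>x\<in>{a..<b}. real_of_int (\<xi> x)\<bar> \<le> 2 * real N" for b
    proof -
      have "real_of_int \<bar>\<Sum>x\<in>{a..<b}. \<xi> x\<bar> \<le> real_of_int (2 * int N)"
        unfolding of_int_le_iff by (rule sum_quadratic_character_bound[OF \<xi> \<open>N > 0\<close> t])
      then show ?thesis by simp
    qed
  qed (use \<open>1 \<le> a\<close> in \<open>auto intro!: divide_left_mono\<close>)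
  then show ?thesis by simp
qed

section \<open>Dirichlet convolution of two quadratic characters\<close>

definition character_convolution :: "(nat \<Rightarrow> int) \<Rightarrow> (nat \<Rightarrow> int) \<Rightarrow> nat \<Rightarrow> int" where
  "character_convolution \<phi> \<psi> n = (\<Sum>d | d dvd n. \<phi> d * \<psi> (n div d))"

text \<open>Every divisor of \<open>p ^ k * m\<close> is \<open>p ^ i * d\<close> for a unique pair
  with \<open>i \<le> k\<close> and \<open>d dvd m\<close>, so the divisor sum splits into a local
  factor at \<open>p\<close> and the sum for \<open>m\<close>.\<close>

lemma character_convolution_mult_prime_power:
  assumes \<phi>: "quadratic_character N \<phi>" and \<psi>: "quadratic_character N \<psi>"
    and p: "prime p" "\<not> p dvd m" and "m > 0"
  shows "character_convolution \<phi> \<psi> (p ^ k * m) =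
    (\<Sum>i\<le>k. \<phi> p ^ i * \<psi> p ^ (k - i)) * character_convolution \<phi> \<psi> m"
proof -
  have mult: "multiplicity p (p ^ i * d) = i" if "\<not> p dvd d" for i d
    by (rule multiplicity_eqI) (use p that in auto)
  have "character_convolution \<phi> \<psi> (p ^ k * m) =
      (\<Sum>(i, d)\<in>{..k} \<times> {d. d dvd m}. \<phi> (p ^ i * d) * \<psi> (p ^ k * m div (p ^ i * d)))"
  proof -
    have inj: "inj_on (\<lambda>(i, d). p ^ i * d) ({..k} \<times> {d. d dvd m})"
    proof (rule inj_onI, clarify)
      fix i j d e assume *: "i \<le> k" "j \<le> k" "d dvd m" "e dvd m" "p ^ i * d = p ^ j * e"
      then have "\<not> p dvd d" "\<not> p dvd e" using p(2) by auto
      then have "i = j" using mult[of d i] mult[of e j] *(5) by simp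
      then show "i = j \<and> d = e" using *(5) p(1) by (simp add: prime_gt_0_nat)
    qed
    have "{d. d dvd p ^ k * m} = (\<lambda>(i, d). p ^ i * d) ` ({..k} \<times> {d. d dvd m})"
    proof (intro equalityI subsetI)
      fix x assume "x \<in> {d. d dvd p ^ k * m}"
      then obtain b c where "x = b * c" "b dvd p ^ k" "c dvd m"
        using division_decomp[of x "p ^ k" m] by auto
      then show "x \<in> (\<lambda>(i, d). p ^ i * d) ` ({..k} \<times> {d. d dvd m})"
        using divides_primepow_nat[OF p(1)] by auto
    qed (auto intro: mult_dvd_mono le_imp_power_dvd)
    then show ?thesis
      using sum.reindex[OF inj, of "\<lambda>d. \<phi> d * \<psi> (p ^ k * m div d)"]
      by (simp add: character_convolution_def case_prod_unfold o_def)
  qed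
  also have "\<dots> = (\<Sum>(i, d)\<in>{..k} \<times> {d. d dvd m}. (\<phi> p ^ i * \<psi> p ^ (k - i)) * (\<phi> d * \<psi> (m div d)))"
  proof (rule sum.cong[OF refl], clarify)
    fix i d assume id: "i \<le> k" "d dvd m"
    have "p ^ i * p ^ (k - i) = p ^ k" "d * (m div d) = m"
      using id by (simp_all add: power_add[symmetric])
    moreover have "(p ^ i * p ^ (k - i)) * (d * (m div d)) = (p ^ i * d) * (p ^ (k - i) * (m div d))"
      by (simp only: mult_ac)
    moreover have "p ^ i * d \<noteq> 0" using id p(1) \<open>m > 0\<close> by (auto dest: dvd_pos_nat)
    ultimately have "p ^ k * m div (p ^ i * d) = p ^ (k - i) * (m div d)"
      by (metis nonzero_mult_div_cancel_left)
    then show "\<phi> (p ^ i * d) * \<psi> (p ^ k * m div (p ^ i * d)) =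
        (\<phi> p ^ i * \<psi> p ^ (k - i)) * (\<phi> d * \<psi> (m div d))"
      by (simp add: quadratic_character_mult[OF \<phi>] quadratic_character_mult[OF \<psi>]
          quadratic_character_power[OF \<phi>] quadratic_character_power[OF \<psi>])
  qed
  also have "\<dots> = (\<Sum>i\<le>k. \<phi> p ^ i * \<psi> p ^ (k - i)) * character_convolution \<phi> \<psi> m"
    unfolding character_convolution_def by (simp add: sum_product sum.cartesian_product)
  finally show ?thesis .
qed

lemma sum_alternating: "(\<Sum>i\<le>k. (-1) ^ i) = (if even k then 1 else 0 :: int)"
  by (induction k) auto

text \<open>For \<open>a = b = 1\<close> the sum is \<open>k + 1\<close>; with exactly one negative
  sign it alternates and is 1 or 0 according to the parity of \<open>k\<close>. The excluded case
  would give \<open>(-1) ^ k * (k + 1)\<close>, which is negative for odd \<open>k\<close>.\<close>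

lemma sum_sign_powers:
  fixes a b :: int
  assumes "a \<in> {-1, 1}" "b \<in> {-1, 1}" "\<not> (a = -1 \<and> b = -1)"
  shows "0 \<le> (\<Sum>i\<le>k. a ^ i * b ^ (k - i))"
    and "even k \<Longrightarrow> 1 \<le> (\<Sum>i\<le>k. a ^ i * b ^ (k - i))"
proof -
  have "(\<Sum>i\<le>k. (-1) ^ (k - i)) = (\<Sum>i\<le>k. (-1) ^ i :: int)"
    by (rule sum.reindex_bij_witness[of _ "\<lambda>i. k - i" "\<lambda>i. k - i"]) auto
  then have "(\<Sum>i\<le>k. a ^ i * b ^ (k - i)) \<in> {int k + 1, (if even k then 1 else 0)}"
    using assms by (auto simp: sum_alternating)
  then show "0 \<le> (\<Sum>i\<le>k. a ^ i * b ^ (k - i))"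
    and "even k \<Longrightarrow> 1 \<le> (\<Sum>i\<le>k. a ^ i * b ^ (k - i))" by auto
qed

text \<open>Induction on \<open>n\<close>, splitting off the full power of one prime. Its local
  factor vanishes if the prime divides \<open>N\<close> and is nonnegative otherwise; in a square
  all exponents are even, which makes each factor at a prime not dividing \<open>N\<close> at least
  1.\<close>

lemma character_convolution_nonneg:
  assumes \<phi>: "quadratic_character N \<phi>" and \<psi>: "quadratic_character N \<psi>"
    and sgn: "\<And>p. prime p \<Longrightarrow> \<not> (\<phi> p = -1 \<and> \<psi> p = -1)" and "n > 0"
  shows "0 \<le> character_convolution \<phi> \<psi> n \<and>
    (coprime n N \<longrightarrow> is_square n \<longrightarrow> 1 \<le> character_convolution \<phi> \<psi> n)"
  using \<open>n > 0\<close>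
proof (induction n rule: less_induct)
  case (less n)
  show ?case
  proof (cases "n = 1")
    case True
    then show ?thesis
      using quadratic_character_1[OF \<phi>] quadratic_character_1[OF \<psi>]
      by (simp add: character_convolution_def)
  next
    case False
    then obtain p where p: "prime p" "p dvd n" using prime_factor_nat by blast
    obtain m where n: "n = p ^ multiplicity p n * m" and m: "\<not> p dvd m"
      using multiplicity_decompose'[of n p] less.prems p(1) by (metis neq0_conv not_prime_unit)
    define k where "k = multiplicity p n"
    have n: "n = p ^ k * m" using n by (simp add: k_def)
    have "k > 0" using p less.prems by (simp add: k_def prime_multiplicity_gt_zero_iff)
    have "m > 0" using n less.prems by (cases m) auto
    then have "m < n" unfolding n using p(1) \<open>k > 0\<close>
      by (metis mult_less_cancel2 mult_1 one_less_power prime_gt_1_nat)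
    note IH = less.IH[OF this \<open>m > 0\<close>]
    note conv = character_convolution_mult_prime_power[OF \<phi> \<psi> p(1) m \<open>m > 0\<close>, of k, folded n]
    show ?thesis
    proof (cases "coprime p N")
      case True
      have ab: "\<phi> p \<in> {-1, 1}" "\<psi> p \<in> {-1, 1}"
        using quadratic_character_coprime[OF \<phi> True] quadratic_character_coprime[OF \<psi> True] by auto
      note signs = sum_sign_powers[OF ab sgn[OF p(1)], of k]
      have "even k \<and> is_square m" if "is_square n"
      proof -
        obtain s where s: "n = s ^ 2" using \<open>is_square n\<close> by (rule is_nth_powerE)
        then have k: "k = 2 * multiplicity p s"
          using p(1) less.prems by (simp add: k_def prime_elem_multiplicity_power_distrib)
        moreover have "is_square m"
        proof -
          have "is_square (p ^ k)" using k by (metis is_nth_power_nth_power power_mult mult.commute)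
          moreover have "coprime (p ^ k) m" using p(1) m by (simp add: prime_imp_coprime)
          ultimately show ?thesis
            using that unfolding n by (simp add: is_nth_power_mult_coprime_nat_iff)
        qed
        ultimately show ?thesis by simp
      qed
      moreover have "coprime m N" if "coprime n N" using that n by simp
      moreover have "1 \<le> a * b" if "1 \<le> a" "1 \<le> b" for a b :: int using mult_mono[OF that] that by simp
      ultimately show ?thesis unfolding conv using signs IH by (auto intro: mult_nonneg_nonneg)
    next
      case False
      then have "\<phi> p = 0" "\<psi> p = 0"
        using quadratic_character_eq_0_iff[OF \<phi>] quadratic_character_eq_0_iff[OF \<psi>] by auto
      then have "\<phi> p ^ i * \<psi> p ^ (k - i) = 0" if "i \<le> k" for i
        using \<open>k > 0\<close> that by (cases i) auto
      then have "(\<Sum>i\<le>k. \<phi> p ^ i * \<psi> p ^ (k - i)) = 0" by (intro sum.neutral) simp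
      then have "character_convolution \<phi> \<psi> n = 0" unfolding conv by simp
      moreover have "\<not> coprime n N" using False \<open>k > 0\<close> by (auto simp: n)
      ultimately show ?thesis by simp
    qed
  qed
qed

lemma coprime_iff_if_cong:
  fixes x y N :: nat
  assumes "[x = y] (mod N)"
  shows "coprime x N \<longleftrightarrow> coprime y N"
  using cong_imp_coprime[OF assms] cong_imp_coprime[OF cong_sym[OF assms]] by blast

text \<open>If there is no such prime, then \<open>g\<close> is nonnegative on positive numbers. The
  hyperbola method bounds its sums up to \<open>Y^2\<close> independently of \<open>Y\<close>, while
  the squares coprime to \<open>N\<close> alone contribute a multiple of the harmonic
  series.\<close>

lemma exists_prime_both_characters_minus_one:
  assumes \<phi>: "quadratic_character N \<phi>" and \<psi>: "quadratic_character N \<psi>" and "N > 0"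
    and s: "\<phi> s = -1" and t: "\<psi> t = -1"
  shows "\<exists>p. prime p \<and> \<phi> p = -1 \<and> \<psi> p = -1"
proof (rule ccontr)
  assume "\<not> ?thesis"
  then have sgn: "\<not> (\<phi> p = -1 \<and> \<psi> p = -1)" if "prime p" for p using that by blast
  note conv = character_convolution_nonneg[OF \<phi> \<psi> sgn]
  define C where "C = 2 * real N"
  define g where "g n = real_of_int (character_convolution \<phi> \<psi> n) / sqrt n" for n
  have abs1: "\<bar>real_of_int (\<xi> x) / sqrt x\<bar> \<le> 1 / sqrt x" if "quadratic_character N \<xi>" for \<xi> x
    using quadratic_character_values[OF that, of x] by auto
  have upper: "(\<Sum>n\<in>{1..Y\<^sup>2}. g n) \<le> C\<^sup>2 + 4 * C" if "Y > 0" for Y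
  proof -
    have "g n = (\<Sum>d | d dvd n. (\<phi> d / sqrt d) * (\<psi> (n div d) / sqrt (real (n div d))))" for n
      unfolding g_def character_convolution_def of_int_sum sum_divide_distrib
      by (intro sum.cong refl) (auto elim!: dvdE simp: real_sqrt_mult)
    then have "(\<Sum>n\<in>{1..Y\<^sup>2}. g n) = (\<Sum>(d, e)\<in>hyperbola_region (Y\<^sup>2). (\<phi> d / sqrt d) * (\<psi> e / sqrt e))"
      by (simp only: sum_divisors_eq_sum_hyperbola_region[of "\<lambda>d e. (\<phi> d / sqrt d) * (\<psi> e / sqrt e)"])
    also have "\<dots> \<le> C\<^sup>2 + 4 * C"
      by (rule abs_le_D1, rule hyperbola_bound)
        (use sum_quadratic_character_sqrt_bound[OF \<phi> \<open>N > 0\<close> s] sum_quadratic_character_sqrt_bound[OF \<psi> \<open>N > 0\<close> t]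
          abs1[OF \<phi>] abs1[OF \<psi>] that in \<open>simp_all add: C_def\<close>)
    finally show ?thesis .
  qed
  have lower: "ln (real K + 1) / N \<le> C\<^sup>2 + 4 * C" if "K > 0" for K
  proof -
    \<comment> \<open>Squares of numbers congruent to 1 modulo \<open>N\<close> are coprime to
      \<open>N\<close>. Each contributes at least \<open>1 / (1 + j * N)\<close>, which dominates a
      harmonic term divided by \<open>N\<close>.\<close>
    define f where "f j = (1 + j * N)\<^sup>2" for j
    have inj: "inj_on f {..<K}" using \<open>N > 0\<close> by (auto simp: inj_on_def f_def)
    have "ln (real K + 1) / N \<le> harm K / N" using ln_le_harm[of K] \<open>N > 0\<close> by (simp add: divide_right_mono)
    also have "\<dots> = (\<Sum>j<K. 1 / (real N * (real j + 1)))"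
      by (simp add: harm_def sum.atLeast1_atMost_eq sum_divide_distrib inverse_eq_divide mult.commute add.commute)
    also have "\<dots> \<le> (\<Sum>j<K. g (f j))"
    proof (rule sum_mono)
      fix j
      have "[1 + j * N = 1 + 0] (mod N)" by (intro cong_add) (simp_all add: cong_0_iff)
      then have "coprime (f j) N" unfolding f_def using coprime_iff_if_cong[of "1 + j * N" 1 N] by simp
      moreover have "is_square (f j)" "f j > 0" by (simp_all add: f_def)
      ultimately have "1 \<le> character_convolution \<phi> \<psi> (f j)" using conv[of "f j"] by blast
      moreover have "sqrt (f j) = real (1 + j * N)" by (simp add: f_def)
      ultimately have "1 / real (1 + j * N) \<le> g (f j)" by (simp add: g_def divide_right_mono)
      moreover have "1 / (real N * (real j + 1)) \<le> 1 / real (1 + j * N)"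
      proof (rule frac_le)
        have "1 \<le> real N" using \<open>N > 0\<close> by simp
        then show "real (1 + j * N) \<le> real N * (real j + 1)" by (simp add: algebra_simps)
        show "0 < real (1 + j * N)" by (simp only: of_nat_0_less_iff)
      qed simp_all
      ultimately show "1 / (real N * (real j + 1)) \<le> g (f j)" by simp
    qed
    also have "\<dots> = (\<Sum>n\<in>f ` {..<K}. g n)" by (simp add: sum.reindex[OF inj])
    also have "\<dots> \<le> (\<Sum>n\<in>{1..(K * N)\<^sup>2}. g n)"
    proof (rule sum_mono2)
      have "1 + j * N \<le> K * N" if "j < K" for j
        using mult_le_mono1[of "Suc j" K N] that \<open>N > 0\<close> by simp
      then show "f ` {..<K} \<subseteq> {1..(K * N)\<^sup>2}" unfolding f_def by (auto intro!: power_mono)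
      show "0 \<le> g n" if "n \<in> {1..(K * N)\<^sup>2} - f ` {..<K}" for n
        using that conv[of n] by (simp add: g_def)
    qed simp
    also have "\<dots> \<le> C\<^sup>2 + 4 * C" using that \<open>N > 0\<close> by (intro upper) simp
    finally show ?thesis .
  qed
  \<comment> \<open>With this \<open>B\<close> the estimate \<open>lower\<close> reads
    \<open>ln (K + 1) \<le> B\<close>, and \<open>exp B\<close> rounded up is a \<open>K\<close>
    that violates it.\<close>
  define B where "B = N * (C\<^sup>2 + 4 * C)"
  define K where "K = nat \<lceil>exp B\<rceil>"
  have "exp B \<le> real K" unfolding K_def by (rule real_nat_ceiling_ge)
  moreover have "0 < exp B" by simp
  ultimately have "0 < K" "exp B < real K + 1" by linarith+
  then have "B < ln (real K + 1)" by (metis exp_gt_zero ln_exp ln_less_cancel_iff less_trans)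
  then show False using lower[OF \<open>0 < K\<close>] \<open>N > 0\<close> by (simp add: B_def field_simps)
qed

section \<open>Quadratic characters that separate a unit from a subgroup\<close>

text \<open>A subgroup of the group of units modulo \<open>N\<close> that contains all squares, as a set of
  natural numbers closed under congruence.\<close>

definition square_subgroup :: "nat \<Rightarrow> nat set \<Rightarrow> bool" where
  "square_subgroup N K \<longleftrightarrow> (\<forall>x\<in>K. coprime x N) \<and> (\<forall>x\<in>K. \<forall>y. [x = y] (mod N) \<longrightarrow> y \<in> K) \<and>
     (\<forall>x\<in>K. \<forall>y\<in>K. x * y \<in> K) \<and> (\<forall>x. coprime x N \<longrightarrow> x\<^sup>2 \<in> K)"

text \<open>Squares supply inverses: if \<open>w\<close> inverts \<open>a\<close>, then
  \<open>w^2 * (a * (a * b))\<close> lies in \<open>K\<close> and is congruent to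
  \<open>b\<close>.\<close>

lemma square_subgroup_cancel:
  assumes K: "square_subgroup N K" and "a \<in> K" "a * b \<in> K"
  shows "b \<in> K"
proof -
  have "coprime a N" using K \<open>a \<in> K\<close> by (simp add: square_subgroup_def)
  then obtain w where w: "[a * w = 1] (mod N)" using cong_solve_coprime_nat[of a N] by auto
  then have "coprime w N"
    by (metis cong_imp_coprime cong_sym coprime_1_left coprime_mult_left_iff)
  then have "w\<^sup>2 * (a * (a * b)) \<in> K" using K assms(2,3) by (simp add: square_subgroup_def)
  moreover have "[w\<^sup>2 * (a * (a * b)) = 1 * 1 * b] (mod N)"
  proof -
    have "w\<^sup>2 * (a * (a * b)) = (a * w) * (a * w) * b" by (simp add: power2_eq_square mult_ac)
    then show ?thesis using w by (metis cong_mult cong_refl)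
  qed
  ultimately show ?thesis using K unfolding square_subgroup_def by (metis mult_1)
qed

text \<open>Among the square subgroups that contain \<open>K\<^sub>0\<close> but not
  \<open>t\<close>, a largest one has index 2 in the units; \<psi> is 1 on it and -1 on the other
  units.\<close>

lemma exists_quadratic_character_of_subgroup:
  assumes K0: "square_subgroup N K\<^sub>0" and "N > 0" and t: "coprime t N" "t \<notin> K\<^sub>0"
  obtains \<psi> where "quadratic_character N \<psi>" "\<psi> t = -1" "\<And>x. x \<in> K\<^sub>0 \<Longrightarrow> \<psi> x = 1"
proof -
  define P where "P K \<longleftrightarrow> square_subgroup N K \<and> K\<^sub>0 \<subseteq> K \<and> t \<notin> K" for K
  \<comment> \<open>The subgroups are infinite as sets of natural numbers, so their size is measured
    by the residues below \<open>N\<close>.\<close>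
  have "card (K \<inter> {..<N}) < Suc N" for K
    using card_mono[of "{..<N}" "K \<inter> {..<N}"] by simp
  then have "\<exists>K. P K \<and> (\<forall>L. P L \<longrightarrow> card (L \<inter> {..<N}) \<le> card (K \<inter> {..<N}))"
    using K0 t by (intro ex_has_greatest_nat[of P "K\<^sub>0" _ "Suc N"]) (auto simp: P_def)
  then obtain K where "P K" and max: "\<And>L. P L \<Longrightarrow> card (L \<inter> {..<N}) \<le> card (K \<inter> {..<N})" by blast
  then have K: "square_subgroup N K" "K\<^sub>0 \<subseteq> K" "t \<notin> K" by (simp_all add: P_def)
  have cop: "coprime x N" if "x \<in> K" for x using K(1) that by (simp add: square_subgroup_def)
  have cong: "y \<in> K" if "x \<in> K" "[x = y] (mod N)" for x y
    using K(1) that by (auto simp: square_subgroup_def)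
  have mult: "x * y \<in> K" if "x \<in> K" "y \<in> K" for x y using K(1) that by (simp add: square_subgroup_def)
  have sq: "x\<^sup>2 \<in> K" if "coprime x N" for x using K(1) that by (simp add: square_subgroup_def)
  \<comment> \<open>Since \<open>x^2\<close> is in \<open>K\<close>, the numbers \<open>z\<close>
    with \<open>x * z\<close> in \<open>K\<close> form the coset of \<open>x\<close>. The union
    \<open>L\<close> of this coset with \<open>K\<close> is a subgroup, larger by
    \<open>x mod N\<close> and still without \<open>t\<close>, against maximality.\<close>
  have index2: "x * t \<in> K" if x: "coprime x N" "x \<notin> K" for x
  proof (rule ccontr)
    assume "x * t \<notin> K"
    define L where "L = K \<union> {z. x * z \<in> K}"
    have "square_subgroup N L" unfolding square_subgroup_def
    proof (intro conjI ballI allI impI)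
      show "coprime z N" if "z \<in> L" for z using that cop[of z] cop[of "x * z"] by (auto simp: L_def)
      show "w \<in> L" if "z \<in> L" "[z = w] (mod N)" for z w
        using that cong[of z w] cong[of "x * z" "x * w"] by (auto simp: L_def cong_scalar_left)
      show "z\<^sup>2 \<in> L" if "coprime z N" for z using sq[OF that] by (simp add: L_def)
      fix z w assume zw: "z \<in> L" "w \<in> L"
      have "z * w \<in> K" if "x * z \<in> K" "x * w \<in> K"
        using square_subgroup_cancel[OF K(1) sq[OF x(1)], of "z * w"] mult[OF that]
        by (simp add: power2_eq_square mult_ac)
      moreover have "x * (z * w) \<in> K" if "z \<in> K" "x * w \<in> K"
        using mult[OF that] by (simp add: mult_ac)
      moreover have "x * (z * w) \<in> K" if "x * z \<in> K" "w \<in> K"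
        using mult[OF that] by (simp add: mult_ac)
      ultimately show "z * w \<in> L" using zw mult by (auto simp: L_def)
    qed
    then have "P L" using K \<open>x * t \<notin> K\<close> by (auto simp: P_def L_def)
    have "x mod N \<in> L" using cong[OF sq[OF x(1)], of "x * (x mod N)"]
      by (simp add: L_def power2_eq_square cong_def mod_mult_right_eq)
    moreover have "x mod N \<notin> K" using cong[of "x mod N" x] x(2) by (auto simp: cong_def)
    moreover have "x mod N \<in> {..<N}" "K \<subseteq> L" using \<open>N > 0\<close> by (simp_all add: L_def)
    ultimately have "K \<inter> {..<N} \<subset> L \<inter> {..<N}" by blast
    then have "card (K \<inter> {..<N}) < card (L \<inter> {..<N})" by (intro psubset_card_mono) auto
    then show False using max[OF \<open>P L\<close>] by simp
  qed
  define \<psi> where "\<psi> x = (if coprime x N then if x \<in> K then 1 else -1 else 0 :: int)" for x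
  have prod: "x * y \<in> K \<longleftrightarrow> (x \<in> K \<longleftrightarrow> y \<in> K)" if "coprime x N" "coprime y N" for x y
  proof -
    \<comment> \<open>Both \<open>x * t\<close> and \<open>y * t\<close> lie in \<open>K\<close>;
      their product is \<open>t^2 * (x * y)\<close>, and \<open>t^2\<close> cancels.\<close>
    have "x * y \<in> K" if "x \<notin> K" "y \<notin> K"
      using square_subgroup_cancel[OF K(1) sq[OF t(1)], of "x * y"]
        mult[OF index2[OF \<open>coprime x N\<close> that(1)] index2[OF \<open>coprime y N\<close> that(2)]]
      by (simp add: power2_eq_square mult_ac)
    then show ?thesis
      using mult square_subgroup_cancel[OF K(1), of x y] square_subgroup_cancel[OF K(1), of y x]
      by (auto simp: mult.commute)
  qed
  have "quadratic_character N \<psi>" unfolding quadratic_character_def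
  proof (intro conjI allI impI)
    show "\<psi> 1 = 1" using sq[of 1] by (simp add: \<psi>_def)
    show "\<psi> (x * y) = \<psi> x * \<psi> y" for x y using prod[of x y] by (auto simp: \<psi>_def)
    show "\<psi> x = \<psi> y" if "[x = y] (mod N)" for x y
      using cong[of x y] cong[of y x] that cong_sym[OF that]
      by (auto simp: \<psi>_def coprime_iff_if_cong[OF that])
  qed (auto simp: \<psi>_def)
  moreover have "\<psi> t = -1" using t K by (simp add: \<psi>_def)
  moreover have "\<psi> x = 1" if "x \<in> K\<^sub>0" for x using that K(2) cop by (auto simp: \<psi>_def)
  ultimately show thesis by (rule that)
qed

text \<open>A substitute for Dirichlet's theorem: the quadratic residue class of \<open>t\<close> need not
  contain a prime, but it contains a product of primes on which \<open>\<xi>\<close> is 1.\<close>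

theorem exists_product_of_split_primes:
  assumes \<xi>: "quadratic_character N \<xi>" and "N > 0" and t: "\<xi> t = 1"
  shows "\<exists>h s. h > 0 \<and> coprime s N \<and> [t * s\<^sup>2 = h] (mod N) \<and> (\<forall>q. prime q \<longrightarrow> q dvd h \<longrightarrow> \<xi> q = 1)"
proof (rule ccontr)
  assume neg: "\<not> ?thesis"
  define Q where "Q h \<longleftrightarrow> h > 0 \<and> (\<forall>q. prime q \<longrightarrow> q dvd h \<longrightarrow> \<xi> q = 1)" for h
  \<comment> \<open>The units that agree, up to a square, with a product of primes on which \<xi> is
    1; the negated claim says that \<open>t\<close> is not among them.\<close>
  define K\<^sub>0 where "K\<^sub>0 = {x. coprime x N \<and> (\<exists>h s. Q h \<and> coprime s N \<and> [x * s\<^sup>2 = h] (mod N))}"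
  have Q_mult: "Q (h * k)" if "Q h" "Q k" for h k
    using that by (auto simp: Q_def prime_dvd_mult_iff)
  have Q1: "Q 1" by (auto simp: Q_def)
  have "square_subgroup N K\<^sub>0" unfolding square_subgroup_def
  proof (intro conjI ballI allI impI)
    show "coprime x N" if "x \<in> K\<^sub>0" for x using that by (simp add: K\<^sub>0_def)
    show "y \<in> K\<^sub>0" if "x \<in> K\<^sub>0" "[x = y] (mod N)" for x y
      using that unfolding K\<^sub>0_def
      by (auto simp: coprime_iff_if_cong[OF that(2)]) (metis cong_scalar_right cong_sym cong_trans)
    show "x * y \<in> K\<^sub>0" if xy: "x \<in> K\<^sub>0" "y \<in> K\<^sub>0" for x y
    proof -
      obtain h s where h: "Q h" "coprime s N" "[x * s\<^sup>2 = h] (mod N)" "coprime x N"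
        using xy(1) unfolding K\<^sub>0_def by blast
      obtain k r where k: "Q k" "coprime r N" "[y * r\<^sup>2 = k] (mod N)" "coprime y N"
        using xy(2) unfolding K\<^sub>0_def by blast
      have "[(x * s\<^sup>2) * (y * r\<^sup>2) = h * k] (mod N)" by (rule cong_mult[OF h(3) k(3)])
      then have "[x * y * (s * r)\<^sup>2 = h * k] (mod N)" by (simp add: power_mult_distrib mult_ac)
      moreover have "Q (h * k)" "coprime (s * r) N" "coprime (x * y) N" using h k Q_mult by simp_all
      ultimately show ?thesis unfolding K\<^sub>0_def by blast
    qed
    show "x\<^sup>2 \<in> K\<^sub>0" if x: "coprime x N" for x
    proof -
      obtain w where w: "[x * w = 1] (mod N)" using cong_solve_coprime_nat[OF x] by auto
      then have "coprime w N"
        by (metis cong_imp_coprime cong_sym coprime_1_left coprime_mult_left_iff)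
      moreover have "[x\<^sup>2 * w\<^sup>2 = 1] (mod N)" using cong_pow[OF w, of 2] by (simp add: power_mult_distrib)
      moreover have "coprime (x\<^sup>2) N" using x by simp
      ultimately show ?thesis using Q1 unfolding K\<^sub>0_def by blast
    qed
  qed
  moreover have "coprime t N" using t quadratic_character_eq_0_iff[OF \<xi>, of t] by simp
  moreover have "t \<notin> K\<^sub>0" using neg unfolding K\<^sub>0_def Q_def by blast
  ultimately obtain \<psi> where \<psi>: "quadratic_character N \<psi>" "\<psi> t = -1" "\<And>x. x \<in> K\<^sub>0 \<Longrightarrow> \<psi> x = 1"
    using exists_quadratic_character_of_subgroup \<open>N > 0\<close> by blast
  \<comment> \<open>Both \<xi>\<psi> and \<psi> are -1 at \<open>t\<close>. A prime \<open>p\<close>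
    at which both are -1 has \<xi> equal to 1, so it is itself a product of the allowed kind and
    lies in \<open>K\<^sub>0\<close>, where \<psi> is 1.\<close>
  have "\<xi> t * \<psi> t = -1" using t \<psi>(2) by simp
  then obtain p where p: "prime p" "\<xi> p * \<psi> p = -1" "\<psi> p = -1"
    using exists_prime_both_characters_minus_one[OF quadratic_character_prod[OF \<xi> \<psi>(1)] \<psi>(1) \<open>N > 0\<close>] \<psi>(2)
    by blast
  have "\<xi> q = 1" if "prime q" "q dvd p" for q
    using primes_dvd_imp_eq[OF that(1) p(1) that(2)] p by simp
  then have "Q p" using p(1) by (simp add: Q_def prime_gt_0_nat)
  moreover have "coprime p N" using p quadratic_character_eq_0_iff[OF \<psi>(1), of p] by simp
  moreover have "coprime 1 N" "[p * 1\<^sup>2 = p] (mod N)" by simp_all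
  ultimately have "p \<in> K\<^sub>0" unfolding K\<^sub>0_def by blast
  then show False using \<psi>(3) p(3) by force
qed

section \<open>Quadratic reciprocity for the Jacobi symbol\<close>

lemma Legendre_values: "Legendre a p \<in> {-1, 0, 1}"
  by (auto simp: Legendre_def)

lemma Legendre_eq_0_iff: "Legendre a p = 0 \<longleftrightarrow> p dvd a"
  by (simp add: Legendre_def cong_0_iff)

lemma Legendre_cong: "[a = b] (mod p) \<Longrightarrow> Legendre a p = Legendre b p"
  by (simp add: Legendre_def QuadRes_def cong_def)

text \<open>The values differ by at most 2, hence by less than \<open>p\<close>. This turns the
  congruences from Euler's criterion into equalities of symbols.\<close>

lemma eq_if_cong_mod_odd:
  fixes a b :: int
  assumes "[a = b] (mod int p)" "2 < p" "a \<in> {-1, 0, 1}" "b \<in> {-1, 0, 1}"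
  shows "a = b"
proof -
  have "int p dvd a - b" using assms(1) by (simp add: cong_iff_dvd_diff)
  moreover have "\<bar>a - b\<bar> < int p" using assms(2-4) by auto
  ultimately show ?thesis using zdvd_not_zless[of "\<bar>a - b\<bar>" "int p"] by (cases "a = b") auto
qed

lemma Legendre_mult:
  assumes "prime p" "2 < p"
  shows "Legendre (a * b) (int p) = Legendre a (int p) * Legendre b (int p)"
proof (rule eq_if_cong_mod_odd[OF _ \<open>2 < p\<close>])
  have "[Legendre a p * Legendre b p = a ^ ((p - 1) div 2) * b ^ ((p - 1) div 2)] (mod p)"
    by (intro cong_mult euler_criterion assms)
  then show "[Legendre (a * b) p = Legendre a p * Legendre b p] (mod p)"
    using euler_criterion[OF assms, of "a * b"] by (metis cong_sym cong_trans power_mult_distrib)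
  show "Legendre a (int p) * Legendre b (int p) \<in> {-1, 0, 1}"
    using Legendre_values[of a p] Legendre_values[of b p] by auto
qed (rule Legendre_values)

lemma Legendre_1: "prime p \<Longrightarrow> Legendre 1 (int p) = 1"
  by (auto simp: Legendre_def QuadRes_def cong_0_iff intro!: exI[of _ 1] dest: prime_gt_1_nat)

text \<open>The nonprincipal character modulo 4; at odd primes it is the Legendre symbol of
  -1.\<close>

definition char4 :: "nat \<Rightarrow> int" where
  "char4 x = (if even x then 0 else if x mod 4 = 1 then 1 else -1)"

text \<open>The character modulo 8 that is the Legendre symbol of 2 at odd primes.\<close>

definition char8 :: "nat \<Rightarrow> int" where
  "char8 x = (if even x then 0 else if x mod 8 = 1 \<or> x mod 8 = 7 then 1 else -1)"

lemma Legendre_minus_one: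
  assumes "prime p" "2 < p"
  shows "Legendre (-1) (int p) = char4 p"
proof (rule eq_if_cong_mod_odd[OF _ \<open>2 < p\<close>])
  have "odd p" using assms prime_odd_nat by blast
  then have "(-1) ^ ((p - 1) div 2) = char4 p" unfolding char4_def
    by (simp add: minus_one_power_iff) presburger
  then show "[Legendre (-1) (int p) = char4 p] (mod int p)" using euler_criterion[OF assms, of "-1"] by simp
  show "char4 p \<in> {-1, 0, 1}" by (simp add: char4_def)
qed (rule Legendre_values)

text \<open>Gauss's lemma counts the numbers 2, 4, ..., \<open>2 * k = p - 1\<close> that exceed
  \<open>k\<close>. There are \<open>k - k div 2\<close> of them, and the parity of this count
  depends on \<open>p\<close> modulo 8.\<close>

lemma Legendre_two:
  assumes "prime p" "2 < p"
  shows "Legendre 2 (int p) = char8 p"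
proof -
  have "odd p" using assms prime_odd_nat by blast
  interpret GAUSS p 2
    by unfold_locales (use assms \<open>odd p\<close> in \<open>auto simp: cong_0_iff dest: zdvd_imp_le\<close>)
  define k where "k = (p - 1) div 2"
  have k: "p = 2 * k + 1" using \<open>odd p\<close> by (auto simp: k_def elim: oddE)
  have A: "A = {1..int k}" unfolding A_def by (auto simp: k)
  \<comment> \<open>The doubled numbers stay below \<open>p\<close>, so reduction modulo
    \<open>p\<close> leaves them unchanged.\<close>
  have C: "C = (\<lambda>x. 2 * x) ` {1..int k}"
    unfolding C_def B_def A image_image by (intro image_cong refl) (auto simp: k)
  have half: "(int p - 1) div 2 = int k" by (simp add: k)
  define j where "j = k div 2"
  have j: "int k < 2 * y \<longleftrightarrow> int j + 1 \<le> y" for y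
    unfolding j_def zdiv_int by presburger
  have "E = (\<lambda>x. 2 * x) ` ({1..int k} \<inter> {y. int k < 2 * y})"
    unfolding E_def C half by blast
  also have "{1..int k} \<inter> {y. int k < 2 * y} = {int j + 1..int k}"
    unfolding j by (intro equalityI subsetI) simp_all
  finally have "card E = card {int j + 1..int k}" by (simp add: card_image inj_on_def)
  then have "card E = k - k div 2" by (simp add: j_def)
  moreover have "(-1) ^ (k - k div 2) = char8 p"
  proof -
    define i where "i = k div 4"
    have "k = 4 * i \<or> k = 4 * i + 1 \<or> k = 4 * i + 2 \<or> k = 4 * i + 3" unfolding i_def by linarith
    then have "even (k - k div 2) \<longleftrightarrow> p mod 8 = 1 \<or> p mod 8 = 7"
    proof (elim disjE)
      assume *: "k = 4 * i"
      have "p mod 8 = 1" "even (k - k div 2)"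
        unfolding k * by presburger+
      then show ?thesis by simp
    next
      assume *: "k = 4 * i + 1"
      have "p mod 8 = 3" "odd (k - k div 2)"
        unfolding k * by presburger+
      then show ?thesis by simp
    next
      assume *: "k = 4 * i + 2"
      have "p mod 8 = 5" "odd (k - k div 2)"
        unfolding k * by presburger+
      then show ?thesis by simp
    next
      assume *: "k = 4 * i + 3"
      have "p mod 8 = 7" "even (k - k div 2)"
        unfolding k * by presburger+
      then show ?thesis by simp
    qed
    then show ?thesis using \<open>odd p\<close> by (simp add: char8_def minus_one_power_iff)
  qed
  ultimately show ?thesis using gauss_lemma by simp
qed

section \<open>Characters modulo powers of 2 and modulo odd numbers\<close>

lemma quadratic_character_prod_moduli:
  assumes "quadratic_character M \<phi>" "quadratic_character N \<psi>"
  shows "quadratic_character (M * N) (\<lambda>x. \<phi> x * \<psi> x)"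
proof -
  have "\<phi> x * \<psi> x \<in> {-1, 0, 1}" for x
    using quadratic_character_values[OF assms(1), of x] quadratic_character_values[OF assms(2), of x]
    by auto
  moreover have "\<phi> x * \<psi> x = \<phi> y * \<psi> y" if "[x = y] (mod M * N)" for x y
    using that quadratic_character_cong[OF assms(1), of x y] quadratic_character_cong[OF assms(2), of x y]
      cong_dvd_modulus_nat[OF that, of M] cong_dvd_modulus_nat[OF that, of N] by simp
  ultimately show ?thesis using assms unfolding quadratic_character_def by (simp add: mult_ac)
qed

lemma quadratic_character_one: "quadratic_character 1 (\<lambda>_. 1)"
  by (simp add: quadratic_character_def)

lemma quadratic_character_parity: "quadratic_character 2 (\<lambda>x. if even x then 0 else 1)"
  by (auto simp: quadratic_character_def cong_def) presburger+

lemma char4_mod: "char4 (x mod 4) = char4 x"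
  by (simp add: char4_def dvd_mod_iff)

lemma char4_cong: "[x = y] (mod 4) \<Longrightarrow> char4 x = char4 y"
  by (metis char4_mod cong_def)

lemma char4_mult: "char4 (x * y) = char4 x * char4 y"
proof -
  have *: "char4 (a * b) = char4 a * char4 b" if "a \<in> {0, 1, 2, 3}" "b \<in> {0, 1, 2, 3}" for a b
    using that by (elim insertE emptyE) (simp_all add: char4_def)
  have "x mod 4 \<in> {0, 1, 2, 3}" "y mod 4 \<in> {0, 1, 2, 3}" by auto
  then have "char4 ((x mod 4) * (y mod 4)) = char4 x * char4 y"
    using *[of "x mod 4" "y mod 4"] by (simp only: char4_mod)
  then show ?thesis using char4_mod[of "x * y"] char4_mod[of "(x mod 4) * (y mod 4)"]
    by (simp only: mod_mult_eq)
qed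

lemma char8_mod: "char8 (x mod 8) = char8 x"
  by (simp add: char8_def dvd_mod_iff)

lemma char8_cong: "[x = y] (mod 8) \<Longrightarrow> char8 x = char8 y"
  by (metis char8_mod cong_def)

lemma char8_mult: "char8 (x * y) = char8 x * char8 y"
proof -
  have *: "char8 (a * b) = char8 a * char8 b" if "a \<in> {0, 1, 2, 3, 4, 5, 6, 7}" "b \<in> {0, 1, 2, 3, 4, 5, 6, 7}" for a b
    using that by (elim insertE emptyE) (simp_all add: char8_def)
  have "x mod 8 \<in> {0, 1, 2, 3, 4, 5, 6, 7}" "y mod 8 \<in> {0, 1, 2, 3, 4, 5, 6, 7}" by auto
  then have "char8 ((x mod 8) * (y mod 8)) = char8 x * char8 y"
    using *[of "x mod 8" "y mod 8"] by (simp only: char8_mod)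
  then show ?thesis using char8_mod[of "x * y"] char8_mod[of "(x mod 8) * (y mod 8)"]
    by (simp only: mod_mult_eq)
qed

lemma quadratic_character_char4: "quadratic_character 4 char4"
proof -
  have "coprime x 4 \<longleftrightarrow> odd x" for x :: nat
    using coprime_power_right_iff[of x 2 2] by (simp add: coprime_right_2_iff_odd)
  then show ?thesis unfolding quadratic_character_def
    using char4_cong by (simp add: char4_mult) (simp add: char4_def)
qed

lemma quadratic_character_char8: "quadratic_character 8 char8"
proof -
  have "coprime x 8 \<longleftrightarrow> odd x" for x :: nat
    using coprime_power_right_iff[of x 2 3] by (simp add: coprime_right_2_iff_odd)
  then show ?thesis unfolding quadratic_character_def
    using char8_cong by (simp add: char8_mult) (simp add: char8_def)
qed

lemma quadratic_character_Legendre: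
  assumes "prime p" "2 < p"
  shows "quadratic_character p (\<lambda>x. Legendre (int x) (int p))"
  unfolding quadratic_character_def
proof (intro conjI allI impI)
  show "Legendre (int x) (int p) = 0 \<longleftrightarrow> \<not> coprime x p" for x
    using assms(1) by (metis Legendre_eq_0_iff coprime_absorb_right coprime_commute not_prime_unit of_nat_dvd_iff prime_imp_coprime)
  show "Legendre (int (x * y)) (int p) = Legendre (int x) (int p) * Legendre (int y) (int p)" for x y
    by (simp add: Legendre_mult[OF assms])
  show "Legendre (int x) (int p) = Legendre (int y) (int p)" if "[x = y] (mod p)" for x y
    using that by (intro Legendre_cong) (simp add: cong_int_iff)
qed (use Legendre_values Legendre_1[OF assms(1)] in auto)

text \<open>The Jacobi symbol (x/m); the modulus comes first so that \<open>Jacobi m\<close> is a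
  character.\<close>

definition Jacobi :: "nat \<Rightarrow> nat \<Rightarrow> int" where
  "Jacobi m x = (\<Prod>p\<in>#prime_factorization m. Legendre (int x) (int p))"

lemma odd_prime_gt_2: "prime p \<Longrightarrow> p dvd m \<Longrightarrow> odd m \<Longrightarrow> 2 < p" for p m :: nat
  by (metis dvd_trans le_neq_implies_less prime_ge_2_nat)

lemma quadratic_character_Jacobi:
  assumes "odd m"
  shows "quadratic_character m (Jacobi m)"
proof -
  have "quadratic_character (prod_mset A) (\<lambda>x. \<Prod>p\<in>#A. Legendre (int x) (int p))"
    if "\<And>p. p \<in># A \<Longrightarrow> prime p \<and> 2 < p" for A
    using that
  proof (induction A)
    case empty
    show ?case using quadratic_character_one by simp
  next
    case (add p A)
    then show ?case
      using quadratic_character_prod_moduli[OF quadratic_character_Legendre, of p "prod_mset A"] by simp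
  qed
  moreover have "prime p \<and> 2 < p" if "p \<in># prime_factorization m" for p
    using that assms odd_prime_gt_2[of p m] by auto
  moreover have "prod_mset (prime_factorization m) = m"
    using assms by (intro prod_mset_prime_factorization_nat) (auto intro: Nat.gr0I)
  ultimately show ?thesis unfolding Jacobi_def by metis
qed

text \<open>Complete multiplicativity carries evaluations at the prime factors of \<open>m\<close>
  over to \<open>m\<close>.\<close>

lemma prod_mset_char:
  assumes "quadratic_character N \<xi>" "m > 0"
  shows "(\<Prod>p\<in>#prime_factorization m. \<xi> p) = \<xi> m"
proof -
  have "(\<Prod>p\<in>#A. \<xi> p) = \<xi> (prod_mset A)" for A
    by (induction A) (use quadratic_character_1[OF assms(1)] quadratic_character_mult[OF assms(1)] in simp_all)
  then show ?thesis using assms(2) by (simp add: prod_mset_prime_factorization_nat)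
qed

text \<open>The natural number \<open>x\<close> stands for \<open>-1\<close>.\<close>

lemma Jacobi_minus_one:
  assumes "odd m" "m dvd x + 1"
  shows "Jacobi m x = char4 m"
proof -
  have "Legendre (int x) (int p) = char4 p" if "p \<in># prime_factorization m" for p
  proof -
    have p: "prime p" "p dvd m" using that by auto
    have "int p dvd int (x + 1)" using p(2) assms(2) by (metis dvd_trans of_nat_dvd_iff)
    then have "Legendre (int x) (int p) = Legendre (-1) (int p)"
      by (intro Legendre_cong) (simp add: cong_iff_dvd_diff add.commute)
    then show ?thesis using Legendre_minus_one odd_prime_gt_2 p assms(1) by simp
  qed
  then have "Jacobi m x = (\<Prod>p\<in>#prime_factorization m. char4 p)"
    unfolding Jacobi_def by (intro arg_cong[of _ _ prod_mset] image_mset_cong) auto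
  then show ?thesis using prod_mset_char[OF quadratic_character_char4] assms(1)
    by (metis odd_pos)
qed

lemma Jacobi_two:
  assumes "odd m"
  shows "Jacobi m 2 = char8 m"
proof -
  have "Legendre (int 2) (int p) = char8 p" if "p \<in># prime_factorization m" for p
    using that Legendre_two odd_prime_gt_2[of p m] assms by auto
  then have "Jacobi m 2 = (\<Prod>p\<in>#prime_factorization m. char8 p)"
    unfolding Jacobi_def by (intro arg_cong[of _ _ prod_mset] image_mset_cong) auto
  then show ?thesis using prod_mset_char[OF quadratic_character_char8] assms
    by (metis odd_pos)
qed

text \<open>The sign is written as a multiplicative function of \<open>p\<close>, either 1 or
  \<open>char4 p\<close>, so that the law can be multiplied over the prime factors of an odd number.
  The symbol (q/p) is nonzero, squares to 1 and so moves to the other side.\<close>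

lemma Legendre_prime_reciprocity:
  assumes "prime p" "2 < p" "prime q" "2 < q" "p \<noteq> q"
  shows "Legendre (int p) (int q) = Legendre (int q) (int p) * (if q mod 4 = 1 then 1 else char4 p)"
proof -
  define s :: int where "s = (-1) ^ ((p - 1) div 2 * ((q - 1) div 2))"
  have "odd p" "odd q" using assms prime_odd_nat by blast+
  have half: "odd x \<Longrightarrow> even ((x - 1) div 2) \<longleftrightarrow> x mod 4 = 1" for x :: nat by presburger
  have s: "s = (if q mod 4 = 1 then 1 else char4 p)"
    using half[OF \<open>odd p\<close>] half[OF \<open>odd q\<close>] \<open>odd p\<close>
    by (simp add: s_def char4_def minus_one_power_iff)
  have "\<not> q dvd p" using assms primes_dvd_imp_eq by blast
  then have "Legendre (int q) (int p) \<noteq> 0"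
    using assms by (metis Legendre_eq_0_iff of_nat_dvd_iff primes_dvd_imp_eq)
  then have "Legendre (int q) (int p) * Legendre (int q) (int p) = 1"
    using Legendre_values[of "int q" "int p"] by auto
  moreover have "Legendre (int p) (int q) * Legendre (int q) (int p) = s"
    unfolding s_def by (rule Quadratic_Reciprocity[OF assms])
  ultimately have "Legendre (int p) (int q) = Legendre (int q) (int p) * s"
    by (metis mult.assoc mult.commute mult_1)
  then show ?thesis by (simp add: s)
qed

text \<open>The product of the laws for the prime factors of \<open>m\<close>; coprimality keeps
  these different from \<open>q\<close>.\<close>

lemma Jacobi_reciprocity:
  assumes "odd m" "prime q" "2 < q" "coprime q m"
  shows "Legendre (int m) (int q) = Jacobi m q * (if q mod 4 = 1 then 1 else char4 m)"
proof -
  have "Legendre (int m) (int q) = (\<Prod>p\<in>#prime_factorization m. Legendre (int p) (int q))"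
    by (rule prod_mset_char[OF quadratic_character_Legendre[OF assms(2,3)], symmetric])
      (use assms(1) in \<open>auto intro: Nat.gr0I\<close>)
  also have "\<dots> = (\<Prod>p\<in>#prime_factorization m. Legendre (int q) (int p) * (if q mod 4 = 1 then 1 else char4 p))"
  proof (intro arg_cong[of _ _ prod_mset] image_mset_cong Legendre_prime_reciprocity assms)
    fix p assume "p \<in># prime_factorization m"
    then have p: "prime p" "p dvd m" by auto
    then show "prime p" "2 < p" using odd_prime_gt_2 assms(1) by auto
    show "p \<noteq> q" using p assms by (metis coprime_absorb_left not_prime_unit)
  qed
  also have "\<dots> = Jacobi m q * (if q mod 4 = 1 then 1 else (\<Prod>p\<in>#prime_factorization m. char4 p))"
    by (simp add: Jacobi_def prod_mset.distrib)
  also have "(\<Prod>p\<in>#prime_factorization m. char4 p) = char4 m"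
    by (rule prod_mset_char[OF quadratic_character_char4]) (use assms(1) in \<open>auto intro: Nat.gr0I\<close>)
  finally show ?thesis .
qed

text \<open>One prime \<open>p\<close> is added at a time. A root modulo \<open>k\<close> is lifted
  to \<open>p * k\<close> by a Newton step if \<open>p\<close> divides \<open>k\<close>, and
  otherwise joined with a root modulo \<open>p\<close> by the Chinese remainder theorem.\<close>

lemma exists_sqrt_mod_odd:
  fixes a :: int
  assumes "odd h" "\<And>p. prime p \<Longrightarrow> p dvd h \<Longrightarrow> Legendre a (int p) = 1"
  shows "\<exists>e. int h dvd e\<^sup>2 - a"
  using assms
proof (induction h rule: less_induct)
  case (less h)
  show ?case
  proof (cases "h = 1")
    case False
    then obtain p where p: "prime p" "p dvd h" using prime_factor_nat by blast
    then obtain k where h: "h = p * k" by blast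
    have p2: "2 < p" using odd_prime_gt_2 p less.prems(1) by blast
    have "k > 0" using h less.prems(1) by (auto intro: Nat.gr0I)
    then have "k < h" using h p2 by simp
    moreover have "odd k" using h less.prems(1) by simp
    ultimately obtain e where e: "int k dvd e\<^sup>2 - a" using less.IH[of k] less.prems(2) h by auto
    have L: "Legendre a (int p) = 1" using less.prems(2) p by blast
    then have pa: "\<not> int p dvd a" using Legendre_eq_0_iff[of a "int p"] by simp
    have pp: "prime (int p)" using p(1) by simp
    show ?thesis
    proof (cases "p dvd k")
      case True
      obtain c where c: "e\<^sup>2 - a = int k * c" using e by blast
      have "\<not> int p dvd e"
      proof
        assume "int p dvd e"
        then have "int p dvd e\<^sup>2 - int k * c" using True by (simp add: power2_eq_square)
        then show False using c pa by (simp add: algebra_simps)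
      qed
      moreover have "\<not> int p dvd 2" using p2 by (auto dest: zdvd_imp_le)
      ultimately have "coprime (2 * e) (int p)"
        using pp by (metis coprime_commute prime_dvd_mult_iff prime_imp_coprime)
      then obtain x where x: "[2 * e * x = 1] (mod int p)" using cong_solve_coprime_int by blast
      \<comment> \<open>Newton step, with \<open>x\<close> the inverse of \<open>2 * e\<close>
        modulo \<open>p\<close>: the linear term cancels \<open>c\<close> modulo \<open>p\<close>,
        and the quadratic term is harmless because \<open>p\<close> divides
        \<open>k\<close>.\<close>
      define y where "y = e - int k * (c * x)"
      have "y\<^sup>2 - a = (e\<^sup>2 - a) - 2 * e * int k * (c * x) + int k * (int k * (c * x)\<^sup>2)"
        by (simp add: y_def power2_eq_square algebra_simps)
      also have "\<dots> = int k * (c * (1 - 2 * e * x) + int k * (c * x)\<^sup>2)"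
        unfolding c by (simp add: algebra_simps)
      finally have "y\<^sup>2 - a = int k * (c * (1 - 2 * e * x) + int k * (c * x)\<^sup>2)" .
      moreover have "int p dvd 1 - 2 * e * x" using x cong_iff_dvd_diff cong_sym by blast
      then have "int p dvd c * (1 - 2 * e * x) + int k * (c * x)\<^sup>2" using True by simp
      ultimately have "int h dvd y\<^sup>2 - a" by (simp add: h mult.commute[of "int p"])
      then show ?thesis by blast
    next
      case False
      then have "coprime (int k) (int p)" using prime_imp_coprime[OF p(1) False] by (simp add: coprime_commute)
      moreover obtain f where f: "int p dvd f\<^sup>2 - a"
        using L by (auto simp: Legendre_def QuadRes_def cong_iff_dvd_diff split: if_splits)
      ultimately obtain y where y: "[y = e] (mod int k)" "[y = f] (mod int p)"
        using binary_chinese_remainder_int by blast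
      have "int k dvd y\<^sup>2 - a" "int p dvd y\<^sup>2 - a"
        using e f y by (metis cong_iff_dvd_diff cong_pow cong_trans)+
      then have "int h dvd y\<^sup>2 - a"
        using \<open>coprime (int k) (int p)\<close> by (simp add: h divides_mult mult.commute)
      then show ?thesis by blast
    qed
  qed simp
qed

section \<open>Ternary forms of determinant 1\<close>

text \<open>The symmetric matrix has diagonal \<open>a\<close>, \<open>b\<close>, \<open>c\<close>
  and the entries \<open>d\<close>, \<open>e\<close>, \<open>f\<close> at positions (2,3), (1,3),
  (1,2).\<close>

definition gram3 :: "int \<Rightarrow> int \<Rightarrow> int \<Rightarrow> int \<Rightarrow> int \<Rightarrow> int \<Rightarrow> bool" where
  "gram3 a b c d e f \<longleftrightarrow> (\<exists>u1 u2 u3 v1 v2 v3 w1 w2 w3.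
     a = u1\<^sup>2 + u2\<^sup>2 + u3\<^sup>2 \<and> b = v1\<^sup>2 + v2\<^sup>2 + v3\<^sup>2 \<and> c = w1\<^sup>2 + w2\<^sup>2 + w3\<^sup>2 \<and>
     d = v1 * w1 + v2 * w2 + v3 * w3 \<and> e = u1 * w1 + u2 * w2 + u3 * w3 \<and>
     f = u1 * v1 + u2 * v2 + u3 * v3)"

text \<open>Same layout as for \<open>gram3\<close>. The leading minors of orders 1 and 2 are
  positive and the determinant is 1, so the matrix is positive definite by Sylvester's
  criterion.\<close>

definition unimodular3 :: "int \<Rightarrow> int \<Rightarrow> int \<Rightarrow> int \<Rightarrow> int \<Rightarrow> int \<Rightarrow> bool" where
  "unimodular3 a b c d e f \<longleftrightarrow> 0 < a \<and> 0 < a * b - f\<^sup>2 \<and>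
     a * b * c + 2 * d * e * f - a * d\<^sup>2 - b * e\<^sup>2 - c * f\<^sup>2 = 1"

section \<open>Gram matrices under changes of basis\<close>

lemma gram3I:
  assumes "a = u1\<^sup>2 + u2\<^sup>2 + u3\<^sup>2" "b = v1\<^sup>2 + v2\<^sup>2 + v3\<^sup>2" "c = w1\<^sup>2 + w2\<^sup>2 + w3\<^sup>2"
    "d = v1 * w1 + v2 * w2 + v3 * w3" "e = u1 * w1 + u2 * w2 + u3 * w3" "f = u1 * v1 + u2 * v2 + u3 * v3"
  shows "gram3 a b c d e f"
  using assms unfolding gram3_def by blast

lemma gram3E:
  assumes "gram3 a b c d e f"
  obtains u1 u2 u3 v1 v2 v3 w1 w2 w3 where
    "a = u1\<^sup>2 + u2\<^sup>2 + u3\<^sup>2" "b = v1\<^sup>2 + v2\<^sup>2 + v3\<^sup>2" "c = w1\<^sup>2 + w2\<^sup>2 + w3\<^sup>2"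
    "d = v1 * w1 + v2 * w2 + v3 * w3" "e = u1 * w1 + u2 * w2 + u3 * w3" "f = u1 * v1 + u2 * v2 + u3 * v3"
  using assms unfolding gram3_def by blast

lemma gram3_swap12:
  assumes "gram3 a b c d e f"
  shows "gram3 b a c e d f"
  using assms
proof (rule gram3E)
  fix u1 u2 u3 v1 v2 v3 w1 w2 w3
  show "gram3 b a c e d f" if
    "a = u1\<^sup>2 + u2\<^sup>2 + u3\<^sup>2" "b = v1\<^sup>2 + v2\<^sup>2 + v3\<^sup>2" "c = w1\<^sup>2 + w2\<^sup>2 + w3\<^sup>2"
    "d = v1 * w1 + v2 * w2 + v3 * w3" "e = u1 * w1 + u2 * w2 + u3 * w3" "f = u1 * v1 + u2 * v2 + u3 * v3"
    by (rule gram3I[of _ v1 v2 v3 _ u1 u2 u3 _ w1 w2 w3]) (simp_all add: that mult.commute)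
qed

lemma gram3_swap23:
  assumes "gram3 a b c d e f"
  shows "gram3 a c b d f e"
  using assms
proof (rule gram3E)
  fix u1 u2 u3 v1 v2 v3 w1 w2 w3
  show "gram3 a c b d f e" if
    "a = u1\<^sup>2 + u2\<^sup>2 + u3\<^sup>2" "b = v1\<^sup>2 + v2\<^sup>2 + v3\<^sup>2" "c = w1\<^sup>2 + w2\<^sup>2 + w3\<^sup>2"
    "d = v1 * w1 + v2 * w2 + v3 * w3" "e = u1 * w1 + u2 * w2 + u3 * w3" "f = u1 * v1 + u2 * v2 + u3 * v3"
    by (rule gram3I[of _ u1 u2 u3 _ w1 w2 w3 _ v1 v2 v3]) (simp_all add: that mult.commute)
qed

text \<open>The vector \<open>v\<close> is replaced by \<open>v + k * u\<close>.\<close>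

lemma gram3_shift12:
  assumes "gram3 a b c d e f"
  shows "gram3 a (b + 2 * k * f + k\<^sup>2 * a) c (d + k * e) e (f + k * a)"
proof -
  obtain u1 u2 u3 v1 v2 v3 w1 w2 w3 where *:
    "a = u1\<^sup>2 + u2\<^sup>2 + u3\<^sup>2" "b = v1\<^sup>2 + v2\<^sup>2 + v3\<^sup>2" "c = w1\<^sup>2 + w2\<^sup>2 + w3\<^sup>2"
    "d = v1 * w1 + v2 * w2 + v3 * w3" "e = u1 * w1 + u2 * w2 + u3 * w3" "f = u1 * v1 + u2 * v2 + u3 * v3"
    using assms by (rule gram3E)
  show ?thesis
    by (rule gram3I[of _ u1 u2 u3 _ "v1 + k * u1" "v2 + k * u2" "v3 + k * u3" _ w1 w2 w3])
      (simp_all add: * power2_eq_square algebra_simps)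
qed

text \<open>The vector \<open>w\<close> is replaced by \<open>w + k * v\<close>; this is the
  previous shift after a cyclic permutation of the basis.\<close>

lemma gram3_shift23:
  assumes "gram3 a b c d e f"
  shows "gram3 a b (c + 2 * k * d + k\<^sup>2 * b) (d + k * b) (e + k * f) f"
proof -
  have "gram3 b c a e f d" by (rule gram3_swap23[OF gram3_swap12[OF assms]])
  then have "gram3 b (c + 2 * k * d + k\<^sup>2 * b) a (e + k * f) f (d + k * b)" by (rule gram3_shift12)
  then show ?thesis by (rule gram3_swap12[OF gram3_swap23])
qed

text \<open>The quotient \<open>q\<close> is \<open>x / a\<close> rounded to a nearest integer, and
  \<open>k\<close> is \<open>- q\<close>.\<close>

lemma exists_near_multiple:
  fixes x :: int
  assumes "0 < a"
  obtains k where "2 * \<bar>x + k * a\<bar> \<le> a"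
proof -
  define q r where "q = (2 * x + a) div (2 * a)" and "r = (2 * x + a) mod (2 * a)"
  have "2 * x + a = 2 * (q * a) + r"
    using mult_div_mod_eq[of "2 * a" "2 * x + a"] by (simp add: q_def r_def mult_ac)
  moreover have "0 \<le> r" "r < 2 * a" using assms by (simp_all add: r_def)
  ultimately have "- a \<le> 2 * (x - q * a)" "2 * (x - q * a) \<le> a" by (simp_all add: right_diff_distrib)
  then have "2 * \<bar>x - q * a\<bar> \<le> a" by (cases "0 \<le> x - q * a") simp_all
  then show ?thesis using that[of "- q"] by simp
qed

section \<open>Positive matrices of determinant 1 under the same changes of basis\<close>

lemma unimodular3_swap12:
  assumes "unimodular3 a b c d e f"
  shows "unimodular3 b a c e d f"
proof -
  have "0 < a" "f\<^sup>2 < a * b" using assms by (simp_all add: unimodular3_def)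
  then have "0 < b" by (metis order_le_less_trans zero_le_power2 zero_less_mult_pos)
  then show ?thesis using assms by (simp add: unimodular3_def algebra_simps)
qed

text \<open>Expanding \<open>a\<close> times the determinant by 2x2 minors gives the second claim,
  which makes the minor \<open>a * c - e^2\<close> positive. The reduction below uses it to compare
  this minor with \<open>a * b - f^2\<close>.\<close>

lemma unimodular3_swap23:
  assumes "unimodular3 a b c d e f"
  shows "unimodular3 a c b d f e" "(a * b - f\<^sup>2) * (a * c - e\<^sup>2) = a + (a * d - e * f)\<^sup>2"
proof -
  have "a * (a * b * c + 2 * d * e * f - a * d\<^sup>2 - b * e\<^sup>2 - c * f\<^sup>2) =
      (a * b - f\<^sup>2) * (a * c - e\<^sup>2) - (a * d - e * f)\<^sup>2"
    by (simp add: power2_eq_square algebra_simps)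
  then show *: "(a * b - f\<^sup>2) * (a * c - e\<^sup>2) = a + (a * d - e * f)\<^sup>2"
    using assms by (simp add: unimodular3_def)
  have "0 < (a * b - f\<^sup>2) * (a * c - e\<^sup>2)"
    unfolding * using assms by (simp add: unimodular3_def add_pos_nonneg)
  then have "0 < a * c - e\<^sup>2" using assms by (simp add: unimodular3_def zero_less_mult_iff)
  then show "unimodular3 a c b d f e" using assms by (simp add: unimodular3_def algebra_simps)
qed

lemma unimodular3_shift12:
  assumes "unimodular3 a b c d e f"
  shows "unimodular3 a (b + 2 * k * f + k\<^sup>2 * a) c (d + k * e) e (f + k * a)"
    and "a * (b + 2 * k * f + k\<^sup>2 * a) - (f + k * a)\<^sup>2 = a * b - f\<^sup>2"
proof -
  show *: "a * (b + 2 * k * f + k\<^sup>2 * a) - (f + k * a)\<^sup>2 = a * b - f\<^sup>2"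
    by (simp add: power2_eq_square algebra_simps)
  show "unimodular3 a (b + 2 * k * f + k\<^sup>2 * a) c (d + k * e) e (f + k * a)"
    using assms unfolding unimodular3_def * by (simp add: power2_eq_square algebra_simps)
qed

lemma unimodular3_shift23:
  assumes "unimodular3 a b c d e f"
  shows "unimodular3 a b (c + 2 * k * d + k\<^sup>2 * b) (d + k * b) (e + k * f) f"
  using assms unfolding unimodular3_def by (simp add: power2_eq_square algebra_simps)

text \<open>Induction on the pair (leading coefficient, leading minor): a reduced form of determinant 1
  has both equal to 1, by the Hermite inequalities \<open>3 a\<^sup>2 \<le> 4 K\<close> and \<open>3 K\<^sup>2 \<le> 4 a\<close>.\<close>

lemma unimodular3_imp_gram3: "unimodular3 a b c d e f \<Longrightarrow> gram3 a b c d e f"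
proof (induction "(nat a, nat (a * b - f\<^sup>2))" arbitrary: a b c d e f
    rule: wf_induct_rule[OF wf_lex_prod[OF wf_less_than wf_less_than]])
  case (1 a b f c d e)
  have IH: "gram3 a' b' c' d' e' f'"
    if "unimodular3 a' b' c' d' e' f'" "a' < a \<or> a' = a \<and> a' * b' - f'\<^sup>2 < a * b - f\<^sup>2" for a' b' c' d' e' f'
  proof -
    have "0 < a'" "0 < a' * b' - f'\<^sup>2" using that(1) by (simp_all add: unimodular3_def)
    then show ?thesis using that by (intro 1(1)) auto
  qed
  note U = 1(2)
  define K where "K = a * b - f\<^sup>2"
  have pos: "0 < a" "0 < K" using U by (simp_all add: unimodular3_def K_def)
  show ?case
  proof (cases "a = 1 \<and> K = 1")
    case True
    then have "a = 1" "b = 1 + f\<^sup>2" by (auto simp: K_def)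
    moreover have "c = 1 + e\<^sup>2 + (d - e * f)\<^sup>2"
      using U \<open>a = 1\<close> \<open>b = 1 + f\<^sup>2\<close> by (simp add: unimodular3_def power2_eq_square algebra_simps)
    \<comment> \<open>A triangular factor with unit diagonal, as in a Cholesky
      decomposition.\<close>
    ultimately show ?thesis
      by (intro gram3I[of _ 1 0 0 _ f 1 0 _ e "d - e * f" 1]) simp_all
  next
    case False
    \<comment> \<open>\<open>k\<close> reduces \<open>f\<close> modulo \<open>a\<close>.
      \<open>l\<close> reduces the minor \<open>a * d - e * f\<close> modulo \<open>K\<close>, since
      adding \<open>l * v\<close> to \<open>w\<close> changes it by \<open>l * K\<close>.\<close>
    obtain k where k: "2 * \<bar>f + k * a\<bar> \<le> a" using exists_near_multiple pos(1) by blast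
    obtain l where l: "2 * \<bar>(a * d - e * f) + l * K\<bar> \<le> K" using exists_near_multiple pos(2) by blast
    define b1 f1 where "b1 = b + 2 * k * f + k\<^sup>2 * a" and "f1 = f + k * a"
    define c2 d2 e2 where "c2 = c + 2 * l * d + l\<^sup>2 * b" and "d2 = d + l * b" and "e2 = e + l * f"
    note U1 = unimodular3_shift12(1)[OF U, of k, folded b1_def f1_def]
    note U2 = unimodular3_shift23[OF U, of l, folded c2_def d2_def e2_def]
    have K1: "a * b1 - f1\<^sup>2 = K" unfolding b1_def f1_def K_def by (rule unimodular3_shift12(2)[OF U])
    have K2: "K * (a * c2 - e2\<^sup>2) = a + (a * d2 - e2 * f)\<^sup>2"
      unfolding K_def by (rule unimodular3_swap23(2)[OF U2])
    have M2: "a * d2 - e2 * f = (a * d - e * f) + l * K"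
      by (simp add: d2_def e2_def K_def power2_eq_square algebra_simps)
    \<comment> \<open>Either exchanging the first two vectors lowers the leading coefficient, or
      exchanging the last two lowers the leading minor. Otherwise both Hermite inequalities hold and
      force \<open>a = K = 1\<close>.\<close>
    have "b1 < a \<or> a * c2 - e2\<^sup>2 < K"
    proof (rule ccontr)
      assume "\<not> ?thesis"
      then have "a \<le> b1" "K \<le> a * c2 - e2\<^sup>2" by auto
      have "(2 * \<bar>f1\<bar>)\<^sup>2 \<le> a\<^sup>2" using k pos unfolding f1_def by (intro power_mono) auto
      then have f1: "4 * f1\<^sup>2 \<le> a\<^sup>2" by (simp add: power_mult_distrib)
      have "a * a \<le> a * b1" using \<open>a \<le> b1\<close> pos by simp
      then have A: "3 * a\<^sup>2 \<le> 4 * K" using f1 K1 by (simp add: power2_eq_square)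
      have "(2 * \<bar>a * d2 - e2 * f\<bar>)\<^sup>2 \<le> K\<^sup>2" using l pos unfolding M2 by (intro power_mono) auto
      then have m2: "4 * (a * d2 - e2 * f)\<^sup>2 \<le> K\<^sup>2" by (simp add: power_mult_distrib)
      have "K * K \<le> K * (a * c2 - e2\<^sup>2)" using \<open>K \<le> a * c2 - e2\<^sup>2\<close> pos by simp
      then have B: "3 * K\<^sup>2 \<le> 4 * a" using m2 K2 by (simp add: power2_eq_square)
      have "a = 1"
      proof (rule ccontr)
        assume "a \<noteq> 1"
        then have "2 * a \<le> a\<^sup>2" using pos by (simp add: power2_eq_square)
        then have "3 * a \<le> 2 * K" using A by simp
        then have "9 * K\<^sup>2 \<le> 8 * K" using B by simp
        then have "9 * K \<le> 8" using pos by (simp add: power2_eq_square)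
        then show False using pos by simp
      qed
      moreover have "K = 1"
      proof (rule ccontr)
        assume "K \<noteq> 1"
        then have "2 * K \<le> K\<^sup>2" using pos by (simp add: power2_eq_square)
        then show False using B \<open>a = 1\<close> pos \<open>K \<noteq> 1\<close> by simp
      qed
      ultimately show False using False by simp
    qed
    then show ?thesis
    proof
      assume "b1 < a"
      then have "gram3 b1 a c e (d + k * e) f1" by (intro IH[OF unimodular3_swap12[OF U1]]) simp
      then have "gram3 a b1 c (d + k * e) e f1" by (rule gram3_swap12)
      from gram3_shift12[OF this, of "- k"] show ?thesis
        by (simp add: b1_def f1_def power2_eq_square algebra_simps)
    next
      assume "a * c2 - e2\<^sup>2 < K"
      then have "gram3 a c2 b d2 f e2" by (intro IH[OF unimodular3_swap23(1)[OF U2]]) (simp add: K_def)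
      then have "gram3 a b c2 d2 e2 f" by (rule gram3_swap23)
      from gram3_shift23[OF this, of "- l"] show ?thesis
        by (simp add: c2_def d2_def e2_def power2_eq_square algebra_simps)
    qed
  qed
qed

section \<open>Primitive sums of three squares\<close>

text \<open>With \<open>D = (b^2 * H + 1) / m\<close> and \<open>c = (e^2 + D) / H\<close>, the
  matrix with rows \<open>(H, e, 0)\<close>, \<open>(e, c, b)\<close>, \<open>(0, b, m)\<close> has
  second leading minor \<open>D\<close> and determinant \<open>m * D - b^2 * H = 1\<close>. Its
  third Gram vector \<open>w\<close> has norm \<open>m\<close>; a common divisor of its entries
  divides \<open>m\<close> and \<open>b\<close>, the latter being the product of \<open>v\<close>
  and \<open>w\<close>, and hence divides 1.\<close>

lemma exists_primitive_sum_of_three_squares_if: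
  fixes m b e :: int
  assumes "m > 0" "H > 0" and b: "m dvd b\<^sup>2 * H + 1" and e: "H dvd e\<^sup>2 + (b\<^sup>2 * H + 1) div m"
  shows "\<exists>x y z. x\<^sup>2 + y\<^sup>2 + z\<^sup>2 = m \<and> gcd x (gcd y z) = 1"
proof -
  define D where "D = (b\<^sup>2 * H + 1) div m"
  have D: "m * D = b\<^sup>2 * H + 1" using b by (simp add: D_def)
  have "0 < b\<^sup>2 * H + 1" using \<open>H > 0\<close> by (intro add_nonneg_pos) simp_all
  then have "0 < D" using D \<open>m > 0\<close> by (metis zero_less_mult_pos)
  obtain c where c: "e\<^sup>2 + D = H * c" using e by (auto simp: D_def)
  have "H * c * m - H * b\<^sup>2 - m * e\<^sup>2 = 1"
    unfolding c[symmetric] using D by (simp add: algebra_simps)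
  then have "unimodular3 H c m b 0 e"
    using \<open>H > 0\<close> \<open>0 < D\<close> c by (simp add: unimodular3_def)
  then obtain u1 u2 u3 v1 v2 v3 w1 w2 w3 where
    m: "m = w1\<^sup>2 + w2\<^sup>2 + w3\<^sup>2" and b: "b = v1 * w1 + v2 * w2 + v3 * w3"
    by (elim gram3E[OF unimodular3_imp_gram3])
  define g where "g = gcd w1 (gcd w2 w3)"
  have g: "g dvd w1" "g dvd w2" "g dvd w3"
    unfolding g_def by (simp, metis gcd_dvd1 gcd_dvd2 dvd_trans, metis gcd_dvd2 dvd_trans)
  have "g dvd m" "g dvd b" unfolding m b using g by (auto simp: power2_eq_square)
  then have "g dvd m * D - b\<^sup>2 * H" by (auto simp: power2_eq_square)
  then have "g dvd 1" using D by simp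
  then have "gcd w1 (gcd w2 w3) = 1" by (simp add: g_def)
  then show ?thesis using m by (intro exI[of _ w1] exI[of _ w2] exI[of _ w3]) simp
qed

text \<open>For \<alpha> false the first factor is the principal character modulo 2; it keeps 2 out
  of the primes with value 1. The flag \<beta> says that \<open>2 * m\<close> is to be represented
  instead of \<open>m\<close>.\<close>

definition residue_character :: "bool \<Rightarrow> bool \<Rightarrow> nat \<Rightarrow> nat \<Rightarrow> int" where
  "residue_character \<alpha> \<beta> m x = (if \<alpha> then char4 x else if even x then 0 else 1) *
     ((if \<beta> then char8 x else 1) * Jacobi m x)"

lemma quadratic_character_residue_character:
  assumes "odd m"
  shows "\<exists>N>0. m dvd N \<and> quadratic_character N (residue_character \<alpha> \<beta> m)"
proof -
  define M1 where "M1 = (if \<alpha> then 4 else 2 :: nat)"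
  define M2 where "M2 = (if \<beta> then 8 else 1 :: nat)"
  have "quadratic_character M1 (\<lambda>x. if \<alpha> then char4 x else if even x then 0 else 1)"
    using quadratic_character_char4 quadratic_character_parity by (simp add: M1_def)
  moreover have "quadratic_character M2 (\<lambda>x. if \<beta> then char8 x else 1)"
    using quadratic_character_char8 quadratic_character_one by (simp add: M2_def)
  ultimately have "quadratic_character (M1 * (M2 * m)) (residue_character \<alpha> \<beta> m)"
    unfolding residue_character_def
    by (intro quadratic_character_prod_moduli quadratic_character_Jacobi[OF assms])
  moreover have "0 < M1 * (M2 * m)" using assms by (auto simp: M1_def M2_def intro: Nat.gr0I)
  ultimately show ?thesis by (intro exI[of _ "M1 * (M2 * m)"]) simp
qed

text \<open>The value of \<open>\<alpha>\<close> absorbs the sign from quadratic reciprocity.\<close>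

lemma Legendre_eq_residue_character:
  assumes "odd m" "prime q" "residue_character (m mod 4 = 1) \<beta> m q = 1"
  shows "2 < q" "Legendre (- int ((if \<beta> then 2 else 1) * m)) (int q) = 1"
proof -
  have "odd q" using assms(3) by (auto simp: residue_character_def char4_def split: if_splits)
  then show "2 < q" using assms(2) prime_ge_2_nat[of q] by (cases "q = 2") auto
  have "Jacobi m q \<noteq> 0" using assms(3) by (auto simp: residue_character_def)
  then have "coprime q m"
    using quadratic_character_eq_0_iff[OF quadratic_character_Jacobi[OF assms(1)]] by blast
  \<comment> \<open>If \<open>m\<close> is 3 modulo 4, the two signs cancel for every odd
    \<open>q\<close>; if \<open>m\<close> is 1 modulo 4, only \<open>char4 q\<close>
    remains.\<close>
  have sign: "char4 q * (if q mod 4 = 1 then 1 else char4 m) =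
      (if m mod 4 = 1 then char4 q else if even q then 0 else 1)"
    using \<open>odd q\<close> \<open>odd m\<close> by (simp add: char4_def)
  have "- int ((if \<beta> then 2 else 1) * m) = (-1) * ((if \<beta> then 2 else 1) * int m)" by simp
  then have "Legendre (- int ((if \<beta> then 2 else 1) * m)) (int q) =
      char4 q * ((if \<beta> then char8 q else 1) * (Jacobi m q * (if q mod 4 = 1 then 1 else char4 m)))"
    using Jacobi_reciprocity[OF assms(1,2) \<open>2 < q\<close> \<open>coprime q m\<close>]
    by (simp only: Legendre_mult[OF assms(2) \<open>2 < q\<close>] Legendre_minus_one[OF assms(2) \<open>2 < q\<close>])
      (simp add: Legendre_two[OF assms(2) \<open>2 < q\<close>] Legendre_1[OF assms(2)])
  also have "\<dots> = (char4 q * (if q mod 4 = 1 then 1 else char4 m)) * ((if \<beta> then char8 q else 1) * Jacobi m q)"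
    by (simp only: mult_ac)
  also have "\<dots> = residue_character (m mod 4 = 1) \<beta> m q"
    unfolding sign residue_character_def ..
  finally have "Legendre (- int ((if \<beta> then 2 else 1) * m)) (int q) = residue_character (m mod 4 = 1) \<beta> m q" .
  then show "Legendre (- int ((if \<beta> then 2 else 1) * m)) (int q) = 1" using assms(3) by simp
qed

text \<open>Let \<open>n\<close> be the number to be represented and \<open>H = u * h\<close>, where
  \<open>h\<close> is a product of primes modulo which \<open>- n\<close> is a square. As
  \<open>h\<close> is congruent to \<open>t * s^2\<close> and \<open>u * t\<close> to -1 modulo
  \<open>m\<close>, \<open>H\<close> is congruent to \<open>- s^2\<close>, so \<open>b\<close> can
  be an inverse of \<open>s\<close> modulo \<open>m\<close>.\<close>

lemma primitive_sum_of_three_squares_if_residue_character: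
  fixes m u t :: nat
  assumes "odd m" and u: "u \<in> {1, 2}" "\<beta> \<Longrightarrow> u = 1" and t: "m dvd u * t + 1"
    and \<xi>: "residue_character (m mod 4 = 1) \<beta> m t = 1"
  shows "\<exists>x y z. x\<^sup>2 + y\<^sup>2 + z\<^sup>2 = int ((if \<beta> then 2 else 1) * m) \<and> gcd x (gcd y z) = 1"
proof -
  define n where "n = int ((if \<beta> then 2 else 1) * m)"
  obtain N where N: "N > 0" "m dvd N" "quadratic_character N (residue_character (m mod 4 = 1) \<beta> m)"
    using quadratic_character_residue_character[OF assms(1)] by blast
  obtain h s where h: "h > 0" "coprime s N" "[t * s\<^sup>2 = h] (mod N)"
    "\<And>q. prime q \<Longrightarrow> q dvd h \<Longrightarrow> residue_character (m mod 4 = 1) \<beta> m q = 1"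
    using exists_product_of_split_primes[OF N(3,1) \<xi>] by blast
  note L = Legendre_eq_residue_character[OF assms(1) _ h(4), folded n_def]
  have "odd h" using L(1)[of 2] by auto
  then obtain e1 where e1: "int h dvd e1\<^sup>2 + n" using exists_sqrt_mod_odd[of h "- n"] L(2) by auto
  define H where "H = int (u * h)"
  have "int m dvd int s ^ 2 + H"
  proof -
    have "[t * s\<^sup>2 = h] (mod m)" by (rule cong_dvd_modulus_nat[OF h(3) N(2)])
    then have "int m dvd int h - int (t * s\<^sup>2)" using cong_int_iff cong_iff_dvd_diff cong_sym by blast
    moreover have "int m dvd int (u * t + 1)" using t by (simp only: of_nat_dvd_iff)
    ultimately have "int m dvd int u * (int h - int (t * s\<^sup>2)) + int (u * t + 1) * int s ^ 2"
      by (intro dvd_add dvd_mult dvd_mult2)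
    then show ?thesis by (simp add: H_def algebra_simps)
  qed
  have "coprime s m" using h(2) N(2) by (metis coprime_divisors dvd_refl)
  then obtain b0 where b0: "[int s * b0 = 1] (mod int m)"
    using cong_solve_coprime_int[of "int s" "int m"] by auto
  \<comment> \<open>For \<beta> the numbers \<open>b\<close> and \<open>H\<close> must be odd, so
    that 2 divides \<open>b^2 * H + 1\<close>; adding the odd \<open>m\<close> corrects the parity
    of \<open>b\<close>.\<close>
  define b where "b = (if \<beta> \<and> even b0 then b0 + int m else b0)"
  have "int m dvd int s * b - 1"
  proof -
    have "int m dvd int s * b0 - 1" using b0 by (simp add: cong_iff_dvd_diff)
    then have "int m dvd (int s * b0 - 1) + int m * (if \<beta> \<and> even b0 then int s else 0)"
      by (intro dvd_add) simp_all
    also have "(int s * b0 - 1) + int m * (if \<beta> \<and> even b0 then int s else 0) = int s * b - 1"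
      by (simp add: b_def algebra_simps)
    finally show ?thesis .
  qed
  then have "int m dvd b\<^sup>2 * (int s ^ 2 + H) - (int s * b - 1) * (int s * b + 1)"
    by (rule dvd_diff[OF dvd_mult[OF \<open>int m dvd int s ^ 2 + H\<close>] dvd_mult2])
  then have m_dvd: "int m dvd b\<^sup>2 * H + 1" by (simp add: power2_eq_square algebra_simps)
  have n_dvd: "n dvd b\<^sup>2 * H + 1"
  proof (cases \<beta>)
    case True
    then have "odd b" "odd H" using \<open>odd m\<close> \<open>odd h\<close> u(2) by (auto simp: b_def H_def)
    then have "2 dvd b\<^sup>2 * H + 1" by simp
    moreover have "coprime (2::int) (int m)" using \<open>odd m\<close> by simp
    ultimately show ?thesis using m_dvd True by (simp add: n_def divides_mult)
  qed (use m_dvd in \<open>simp add: n_def\<close>)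
  define D where "D = (b\<^sup>2 * H + 1) div n"
  have D: "n * D = b\<^sup>2 * H + 1" using n_dvd by (simp add: D_def)
  \<comment> \<open>Modulo \<open>h\<close>, \<open>n * D\<close> is 1 and \<open>e1^2\<close> is
    \<open>- n\<close>, so \<open>e1 * D\<close> is a square root of \<open>- D\<close>. The odd
    number \<open>h\<close> may be added to adjust the parity when \<open>u = 2\<close>.\<close>
  have h_dvd: "int h dvd (e1 * D + k * int h)\<^sup>2 + D" for k
  proof -
    have "(e1 * D + k * int h)\<^sup>2 + D =
        D\<^sup>2 * (e1\<^sup>2 + n) - D * (n * D - 1) + int h * (2 * k * e1 * D + k\<^sup>2 * int h)"
      by (simp add: power2_eq_square algebra_simps)
    moreover have "int h dvd n * D - 1" unfolding D by (simp add: H_def)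
    ultimately show ?thesis using e1 by simp
  qed
  have "\<exists>e. H dvd e\<^sup>2 + D"
  proof (cases "u = 1")
    case True
    then show ?thesis using h_dvd[of 0] by (auto simp: H_def)
  next
    case False
    then have u2: "u = 2" using u(1) by simp
    obtain k where k: "even ((e1 * D + k * int h)\<^sup>2 + D)"
    proof (cases "even ((e1 * D)\<^sup>2 + D)")
      case True
      then show ?thesis using that[of 0] by simp
    next
      case False
      then show ?thesis using that[of 1] \<open>odd h\<close> by auto
    qed
    moreover have "coprime (2::int) (int h)" using \<open>odd h\<close> by simp
    ultimately have "2 * int h dvd (e1 * D + k * int h)\<^sup>2 + D" by (intro divides_mult h_dvd)
    then show ?thesis unfolding H_def u2 of_nat_mult of_nat_numeral by (rule exI)
  qed
  then obtain e where "H dvd e\<^sup>2 + D" by blast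
  moreover have "n > 0" using \<open>odd m\<close> by (auto simp: n_def intro: Nat.gr0I)
  moreover have "H > 0" using h(1) u(1) by (auto simp: H_def)
  ultimately show ?thesis
    using exists_primitive_sum_of_three_squares_if[of n H b e] n_dvd unfolding D_def n_def by blast
qed

text \<open>The number \<open>t\<close> is prescribed modulo \<open>m\<close> by
  \<open>u * t\<close> being -1, and modulo 8 so that the residue character takes the value
  1.\<close>

theorem primitive_sum_of_three_squares:
  fixes n :: nat
  assumes "n mod 8 \<in> {1, 2, 3, 5, 6}"
  shows "\<exists>x y z. x\<^sup>2 + y\<^sup>2 + z\<^sup>2 = int n \<and> gcd x (gcd y z) = 1"
proof -
  have crt: "\<exists>t. [t = r] (mod 8) \<and> m dvd u * t + 1" if um: "odd m" "coprime u m" for m u r :: nat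
  proof -
    obtain w where "[u * w = 1] (mod m)" using cong_solve_coprime_nat[OF um(2)] by auto
    \<comment> \<open>Here \<open>m - 1\<close> stands for -1.\<close>
    then have "[u * w * (m - 1) = 1 * (m - 1)] (mod m)" by (rule cong_scalar_right)
    then obtain v where v: "[u * v = m - 1] (mod m)" by (metis mult.assoc mult_1)
    have "coprime 8 m" using um(1) coprime_power_left_iff[of 2 3 m] by simp
    then obtain t where t: "[t = r] (mod 8)" "[t = v] (mod m)" using binary_chinese_remainder_nat by blast
    have "[u * t + 1 = u * v + 1] (mod m)" using t(2) by (intro cong_add cong_mult cong_refl)
    also have "[u * v + 1 = (m - 1) + 1] (mod m)" using v by (intro cong_add cong_refl)
    also have "(m - 1) + 1 = m" using um(1) by (cases m) auto
    finally have "m dvd u * t + 1" by (simp add: cong_dvd_iff)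
    then show ?thesis using t(1) by blast
  qed
  have J: "Jacobi m (u * t) = char4 m" if "odd m" "m dvd u * t + 1" for m u t
    using Jacobi_minus_one that by blast
  have t_mod: "odd t \<and> char4 t = (if r = 1 then 1 else -1) \<and> char8 t = (if r = 1 then 1 else -1)"
    if "[t = r] (mod 8)" "r \<in> {1, 3}" for t r :: nat
  proof -
    have "char8 t = char8 r" by (rule char8_cong[OF that(1)])
    moreover have "char4 t = char4 r"
      by (rule char4_cong[OF cong_dvd_modulus_nat[OF that(1)]]) simp
    moreover from this have "char4 t \<noteq> 0" using that(2) by (auto simp: char4_def)
    then have "odd t" by (auto simp: char4_def)
    ultimately show ?thesis using that(2) by (auto simp: char4_def char8_def)
  qed
  consider (A) "n mod 4 = 1" | (B) "n mod 8 = 3" | (C) m where "n = 2 * m" "odd m"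
  proof -
    have "n mod 4 = n mod 8 mod 4" by (simp add: mod_mod_cancel)
    then have "n mod 4 = 1 \<or> n mod 8 = 3 \<or> n mod 4 = 2" using assms by auto
    moreover have "n = 2 * (n div 2) \<and> odd (n div 2)" if "n mod 4 = 2" using that by presburger
    ultimately show thesis using that by metis
  qed
  then show ?thesis
  proof cases
    case A
    have "odd n" using A by presburger
    then obtain t where t: "[t = 1] (mod 8)" "n dvd 1 * t + 1" using crt[of n 1 1] by auto
    have "char4 n = 1" using A \<open>odd n\<close> by (simp add: char4_def)
    then have "residue_character (n mod 4 = 1) False n t = 1"
      using J[OF \<open>odd n\<close> t(2)] t_mod[OF t(1)] by (simp add: residue_character_def)
    from primitive_sum_of_three_squares_if_residue_character[OF \<open>odd n\<close> _ _ t(2) this] show ?thesis by simp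
  next
    case B
    have "odd n" "n mod 4 = 3" using B by presburger+
    \<comment> \<open>Taking \<open>u = 1\<close> would give
      \<open>Jacobi n t = char4 n = -1\<close>; for \<open>u = 2\<close> the factor
      \<open>Jacobi n 2 = char8 n = -1\<close> corrects the sign.\<close>
    then obtain t where t: "[t = 1] (mod 8)" "n dvd 2 * t + 1" using crt[of n 2 1] by auto
    have "Jacobi n 2 * Jacobi n t = char4 n"
      using J[OF \<open>odd n\<close> t(2)] quadratic_character_mult[OF quadratic_character_Jacobi[OF \<open>odd n\<close>]] by simp
    then have "Jacobi n t = 1"
      using Jacobi_two[OF \<open>odd n\<close>] \<open>odd n\<close> \<open>n mod 4 = 3\<close> B by (simp add: char4_def char8_def)
    then have "residue_character (n mod 4 = 1) False n t = 1"
      using t_mod[OF t(1)] \<open>n mod 4 = 3\<close> by (simp add: residue_character_def)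
    from primitive_sum_of_three_squares_if_residue_character[OF \<open>odd n\<close> _ _ t(2) this] show ?thesis by simp
  next
    case C
    \<comment> \<open>If \<open>m\<close> is 1 modulo 4, every factor of the character is 1 for
      \<open>r = 1\<close>. If \<open>m\<close> is 3 modulo 4, then
      \<open>Jacobi m t = char4 m = -1\<close>, and \<open>r = 3\<close> makes
      \<open>char8 t\<close> equal to -1 as well.\<close>
    define r :: nat where "r = (if m mod 4 = 1 then 1 else 3)"
    obtain t where t: "[t = r] (mod 8)" "m dvd 1 * t + 1" using crt[of m 1 r] C by auto
    have "char4 m = (if m mod 4 = 1 then 1 else -1)" using \<open>odd m\<close> by (simp add: char4_def)
    moreover have "r \<in> {1, 3}" by (simp add: r_def)
    ultimately have "residue_character (m mod 4 = 1) True m t = 1"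
      using J[OF \<open>odd m\<close> t(2)] t_mod[OF t(1)] by (simp add: residue_character_def r_def)
    from primitive_sum_of_three_squares_if_residue_character[OF \<open>odd m\<close> _ _ t(2) this] show ?thesis
      using C(1) by simp
  qed
qed

section \<open>The quaternary form\<close>

text \<open>The change of coordinates is inverted; the congruence makes \<open>w\<close> an integer.
  A common divisor of the new variables divides \<open>a\<close>, \<open>b\<close>,
  \<open>c\<close>, \<open>d\<close>, so primitivity carries over.\<close>

lemma Q27_3_primitive_if:
  fixes a b c d :: int
  assumes n: "a\<^sup>2 + b\<^sup>2 + c\<^sup>2 + 3 * d\<^sup>2 = n" and "3 dvd d - a - b"
    and g: "gcd (gcd a b) (gcd c d) = 1"
  shows "\<exists>x y z w. Q27_3 x y z w = n \<and> Gcd {x, y, z, w} = 1"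
proof -
  obtain w where w: "d - a - b = 3 * w" using assms(2) by blast
  define z y where "z = d - w" and "y = - b - w"
  have abd: "a = y + z - w" "b = - y - w" "d = z + w" using w by (simp_all add: z_def y_def)
  have "Q27_3 c y z w = n"
    unfolding n[symmetric] abd by (simp add: Q27_3_def power2_eq_square algebra_simps)
  moreover have "Gcd {c, y, z, w} = 1"
  proof -
    define k where "k = Gcd {c, y, z, w}"
    have "k dvd v" if "v \<in> {c, y, z, w}" for v unfolding k_def using that by (rule Gcd_dvd)
    then have "k dvd c" "k dvd y" "k dvd z" "k dvd w" by simp_all
    then have "k dvd gcd (gcd a b) (gcd c d)" unfolding abd by (intro gcd_greatest) auto
    then have "k dvd 1" using g by simp
    moreover have "0 \<le> k" by (simp add: k_def)
    ultimately show ?thesis by (simp add: k_def)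
  qed
  ultimately show ?thesis by blast
qed

text \<open>Modulo 3 and with free signs, the sum of two entries takes both nonzero classes as soon
  as one entry is nonzero, which primitivity ensures. It takes the class 0 if both entries are zero
  or both nonzero, and among three entries some two are so.\<close>

lemma Q27_3_primitive_if_sum_of_squares:
  fixes a b c d :: int
  assumes n: "a\<^sup>2 + b\<^sup>2 + c\<^sup>2 + 3 * d\<^sup>2 = n" and g: "gcd a (gcd b c) = 1"
  shows "\<exists>x y z w. Q27_3 x y z w = n \<and> Gcd {x, y, z, w} = 1"
proof -
  have signs: ?thesis
    if "3 dvd d - p - q \<or> 3 dvd d - p + q \<or> 3 dvd d + p - q \<or> 3 dvd d + p + q"
      and "p\<^sup>2 + q\<^sup>2 + r\<^sup>2 = a\<^sup>2 + b\<^sup>2 + c\<^sup>2" and "gcd (gcd p q) (gcd r d) = 1" for p q r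
  proof -
    have "p\<^sup>2 + q\<^sup>2 + r\<^sup>2 + 3 * d\<^sup>2 = n" using that(2) n by simp
    then show ?thesis
      using that(1,3) Q27_3_primitive_if[of p q r d n] Q27_3_primitive_if[of p "- q" r d n]
        Q27_3_primitive_if[of "- p" q r d n] Q27_3_primitive_if[of "- p" "- q" r d n] by auto
  qed
  have gcds: "gcd (gcd p q) (gcd r d) = 1" if "gcd p (gcd q r) = 1" for p q r
  proof -
    have "gcd (gcd p q) (gcd r d) dvd gcd p (gcd q r)"
      by (intro gcd_greatest) (meson dvd_trans gcd_dvd1 gcd_dvd2)+
    then show ?thesis using that by simp
  qed
  have "gcd b (gcd c a) = 1" "gcd c (gcd a b) = 1" using g by (simp_all add: ac_simps)
  note thms = signs[of a b c, OF _ _ gcds[OF g]] signs[of b c a, OF _ _ gcds[OF this(1)]]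
    signs[of c a b, OF _ _ gcds[OF this(2)]]
  have "\<not> (3 dvd a \<and> 3 dvd b \<and> 3 dvd c)"
  proof
    assume "3 dvd a \<and> 3 dvd b \<and> 3 dvd c"
    then have "3 dvd gcd a (gcd b c)" by simp
    then show False using g by simp
  qed
  then have "(3 dvd d - a - b \<or> 3 dvd d - a + b \<or> 3 dvd d + a - b \<or> 3 dvd d + a + b) \<or>
      (3 dvd d - b - c \<or> 3 dvd d - b + c \<or> 3 dvd d + b - c \<or> 3 dvd d + b + c) \<or>
      (3 dvd d - c - a \<or> 3 dvd d - c + a \<or> 3 dvd d + c - a \<or> 3 dvd d + c + a)"
    by presburger
  then show ?thesis using thms by (elim disjE) (simp_all add: ac_simps)
qed

theorem theorem4p10: "primitively_universal Q27_3"
  unfolding primitively_universal_def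
proof (intro allI impI)
  fix n :: int assume "n > 0"
  have shift: "\<exists>x y z w. Q27_3 x y z w = n \<and> Gcd {x, y, z, w} = 1"
    if "0 \<le> n - 3 * d\<^sup>2" "(n - 3 * d\<^sup>2) mod 8 \<in> {1, 2, 3, 5, 6}" for d
  proof -
    have "nat (n - 3 * d\<^sup>2) mod 8 = nat ((n - 3 * d\<^sup>2) mod 8)" using that(1) by (simp add: nat_mod_distrib)
    then have "nat (n - 3 * d\<^sup>2) mod 8 \<in> {1, 2, 3, 5, 6}" using that(2) by auto
    then obtain a b c where "a\<^sup>2 + b\<^sup>2 + c\<^sup>2 = int (nat (n - 3 * d\<^sup>2))" "gcd a (gcd b c) = 1"
      using primitive_sum_of_three_squares by metis
    then show ?thesis using that(1) by (intro Q27_3_primitive_if_sum_of_squares[of a b c d n]) simp_all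
  qed
  consider "n mod 8 \<in> {1, 2, 3, 5, 6}" | "n mod 8 \<in> {0, 4}" | "n = 7" | "n mod 8 = 7" "n \<noteq> 7"
  proof -
    have "n mod 8 \<in> {0, 1, 2, 3, 4, 5, 6, 7}" by auto
    then show thesis using that by auto
  qed
  then show "\<exists>x y z w. Q27_3 x y z w = n \<and> Gcd {x, y, z, w} = 1"
  proof cases
    case 1
    then show ?thesis using shift[of 0] \<open>n > 0\<close> by simp
  next
    case 2
    then have "n mod 8 = 0 \<or> n mod 8 = 4" by simp
    moreover have "(n - 3) mod 8 = (n mod 8 - 3) mod 8" by (simp add: mod_diff_left_eq)
    ultimately have "(n - 3) mod 8 = 1 \<or> (n - 3) mod 8 = 5" by auto
    moreover have "3 \<le> n" using \<open>n mod 8 = 0 \<or> n mod 8 = 4\<close> \<open>n > 0\<close> by presburger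
    ultimately show ?thesis using shift[of 1] by auto
  next
    case 3
    \<comment> \<open>Neither 7 nor \<open>7 - 3 = 4\<close> is a primitive sum of three squares,
      and \<open>7 - 12\<close> is negative, so a solution is given directly.\<close>
    then show ?thesis
      by (intro exI[of _ 0] exI[of _ 1] exI[of _ 0] exI[of _ 1]) (simp add: Q27_3_def)
  next
    case 4
    then have "12 \<le> n" "(n - 12) mod 8 = 3" using \<open>n > 0\<close> by presburger+
    then show ?thesis using shift[of 2] by simp
  qed
qed

end
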